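(* Let $a_n,b_n,c_n:\mathbb{R}\to\mathbb{C}$ ($n\in\mathbb{N}$) be differentiable functions of $t\in\mathbb{R}$. Assume that there exists $K\in\mathbb{R}_+$ such that $\max\{|a_n(t)|,|b_n(t)|,|c_n(t)|\}\le K$ for all $n\in\mathbb{N}$ and $t\in\mathbb{R}$, that $c_n(t)\neq0$ for all $n\in\mathbb{N}$ and $t\in\mathbb{R}$, and that $\dot a_1=b_1$. Let $J$, $J_-$, $\mathcal{B}_n$, $C_n$, $\mathcal{P}_0$, $\mathcal{U}$, $\mathcal{F}_J$ be the objects defined in the context. Then the following assertions are equivalent: (e) $\{a_n,b_n,c_n\}_{n\in\mathbb{N}}$ is a solution of the system $$\dot a_n=b_n-b_{n-1},\qquad \dot b_n=b_n(a_{n+1}-a_n)+c_n-c_{n-1},\qquad \dot c_n=c_n(a_{n+2}-a_n),\qquad n\in\mathbb{N},$$ with $b_0\equiv0$, $c_0\equiv0$; that is, $\dot J=[J,J_-]$. (f) For each $n=0,1,\dots$, $$\frac{d}{dt}\mathcal{U}(z^n\mathcal{P}_0)=\mathcal{U}(z^{n+1}\mathcal{P}_0)-\mathcal{U}(z^n\mathcal{P}_0)\,\mathcal{U}(z\mathcal{P}_0).$$ (g) For all $\zeta\in\mathbb{C}$ such that $|\zeta|>\|J\|$, $$\dot{\mathcal{F}}_J(\zeta)=\mathcal{F}_J(\zeta)\big(\zeta I_2-\mathcal{U}(z\mathcal{P}_0)\big)-I_2.$$ (h) For all $\mathcal{B}\in\mathcal{P}^2$, $$\Big(\frac{d}{dt}\mathcal{U}\Big)(\mathcal{B})=\mathcal{U}(z\mathcal{B})-\mathcal{U}(\mathcal{B})\,\mathcal{U}(z\mathcal{P}_0).$$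 (i) For each $n=0,1,\dots$, $$\dot{\mathcal{B}}_n(z)=-C_n\mathcal{B}_{n-1}(z)-D_n\mathcal{B}_n(z),\qquad D_n=\begin{pmatrix}0&0\\ b_{2n+1}&0\end{pmatrix}.$$
   Context: $\mathbb{N}=\{1,2,\dots\}$. The dot and $\frac{d}{dt}$ denote differentiation with respect to $t\in\mathbb{R}$; dependence on $t$ is suppressed in the notation. $[M,N]=MN-NM$; $I_2$ and $\mathcal{O}_2$ are the $2\times2$ identity and null matrices; $\mathcal{M}_{2\times2}$ is the space of complex $2\times2$ matrices. $J=J(t)$ is the infinite matrix (indices $1,2,\dots$) with $J_{n,n}=a_n$, $J_{n,n+1}=1$, $J_{n+1,n}=b_n$, $J_{n+2,n}=c_n$ for $n\in\mathbb{N}$ and all other entries zero; $J_-$ is its strictly lower triangular part. Infinite matrices are identified with operators on $\ell^2$, and $\|J\|$ is the operator norm. For an infinite matrix $M$, $M_{ij}$ denotes the $2\times2$ block formed by rows $2i-1,2i$ and columns $2j-1,2j$; $J^n_{11}=(J^n)_{11}$. For $|z|>\|J\|$, $\mathcal{R}_J(z)=\big((zI-J)^{-1}\big)_{11}=\sum_{n\ge0}J^n_{11}/z^{n+1}$. Polynomials $P_n$: $P_0=1$, $P_{-1}=P_{-2}=0$, $c_{n-1}P_{n-2}(z)+b_nP_{n-1}(z)+(a_{n+1}-z)P_n(z)+P_{n+1}(z)=0$ for $n=0,1,\dots$ (terms containing $P_{-1}$ or $P_{-2}$ vanish). $\mathcal{B}_m(z)=(P_{2m}(z),P_{2m+1}(z))^T$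 for $m\ge0$, $\mathcal{B}_{-1}=0$; thus $\mathcal{B}_0(z)=(1,z-a_1)^T$. For $n\in\mathbb{N}$, $C_n=\begin{pmatrix}c_{2n-1}&b_{2n}\\0&c_{2n}\end{pmatrix}$, and $C_0=\begin{pmatrix}1&0\\-a_1&1\end{pmatrix}$. The derivative $\dot{\mathcal{B}}_n(z)$ is taken for fixed $z$. $\mathcal{P}$ is the space of complex polynomials in $z$, $\mathcal{P}^2=\{(q_1,q_2)^T:q_1,q_2\in\mathcal{P}\}$, and $\mathcal{P}_m=(z^{2m},z^{2m+1})^T$, so $\mathcal{P}_0=(1,z)^T$. A vector of functionals associated with the recurrence relation for $\{P_n\}$ is a map $\mathcal{W}:\mathcal{P}^2\to\mathcal{M}_{2\times2}$, $$\mathcal{W}\begin{pmatrix}q_1\\ q_2\end{pmatrix}=\begin{pmatrix}u^1[q_1]&u^2[q_1]\\ u^1[q_2]&u^2[q_2]\end{pmatrix},$$ where $u^1,u^2:\mathcal{P}\to\mathbb{C}$ are linear functionals such that for all $m\in\mathbb{N}$: $u^i[z^jP_{2m}]=u^i[z^jP_{2m+1}]=0$ for $j=0,\dots,m-1$, $i=1,2$, and $u^1[z^mP_{2m+1}]=0$. For $M\in\mathcal{M}_{2\times2}$ put $\mathcal{W}_M(\mathcal{Q})=\mathcal{W}(\mathcal{Q})M$. For each $t$ a vector of functionals $\mathcal{W}$ associated with the recurrence is fixed such that $\mathcal{W}(\mathcal{B}_0)$ is invertible, and $\mathcal{U}=\mathcal{W}_M$ with $M=(\mathcal{W}(\mathcal{B}_0))^{-1}C_0$.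 Then $\mathcal{U}$ (which depends on $t$) satisfies, for each $m\in\mathbb{N}\cup\{0\}$, $\mathcal{U}(z^j\mathcal{B}_m)=\mathcal{O}_2$ for $j=0,\dots,m-1$ and $\mathcal{U}(z^m\mathcal{B}_m)=C_mC_{m-1}\cdots C_0$. The derivative $\frac{d\mathcal{U}}{dt}:\mathcal{P}^2\to\mathcal{M}_{2\times2}$ is $\frac{d\mathcal{U}}{dt}(\mathcal{B})=\lim_{\Delta t\to0}\frac{\mathcal{U}\{t+\Delta t\}(\mathcal{B})-\mathcal{U}\{t\}(\mathcal{B})}{\Delta t}$, where $\mathcal{U}\{t\}$ is $\mathcal{U}$ at time $t$. The generating function of the moments is $\mathcal{F}_J(\zeta)=C_0^{-1}\mathcal{R}_J(\zeta)C_0$, $|\zeta|>\|J\|$. *)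

theory Defs
  imports "HOL-Analysis.Analysis"
begin

section \<open>The space of square-summable sequences\<close>

text \<open>The coordinate with number \<open>k\<close> (counted from \<open>0\<close>) of an element of \<open>ell2\<close> is the one that
  belongs to row or column \<open>Suc k\<close> of an infinite matrix with indices \<open>1, 2, \<dots>\<close>.\<close>

typedef ell2 = "{x :: nat \<Rightarrow> complex. summable (\<lambda>k. (cmod (x k))\<^sup>2)}"
  morphisms ell2_coord Abs_ell2
  by (rule exI[of _ "\<lambda>_. 0"]) simp

setup_lifting type_definition_ell2

lemma summable_ell2_coord: "summable (\<lambda>k. (cmod (ell2_coord x k))\<^sup>2)"
  using ell2_coord[of x] by simp

lemma summable_cmod_add_power2:
  fixes x y :: "nat \<Rightarrow> complex"
  assumes "summable (\<lambda>k. (cmod (x k))\<^sup>2)" and "summable (\<lambda>k. (cmod (y k))\<^sup>2)"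
  shows "summable (\<lambda>k. (cmod (x k + y k))\<^sup>2)"
proof (rule summable_comparison_test')
  show "summable (\<lambda>k. 2 * (cmod (x k))\<^sup>2 + 2 * (cmod (y k))\<^sup>2)"
    using assms by (intro summable_add summable_mult)
next
  fix k :: nat
  have "(cmod (x k + y k))\<^sup>2 \<le> (cmod (x k) + cmod (y k))\<^sup>2"
    by (intro power_mono norm_triangle_ineq) simp
  also have "\<dots> \<le> 2 * (cmod (x k))\<^sup>2 + 2 * (cmod (y k))\<^sup>2"
    using sum_squares_bound[of "cmod (x k)" "cmod (y k)"] by (simp add: power2_sum)
  finally show "norm ((cmod (x k + y k))\<^sup>2) \<le> 2 * (cmod (x k))\<^sup>2 + 2 * (cmod (y k))\<^sup>2"
    by simp
qed

lemma summable_cmod_mult_power2: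
  fixes x y :: "nat \<Rightarrow> complex"
  assumes "summable (\<lambda>k. (cmod (x k))\<^sup>2)" and "\<And>k. cmod (y k) \<le> K"
  shows "summable (\<lambda>k. (cmod (y k * x k))\<^sup>2)"
proof (rule summable_comparison_test')
  show "summable (\<lambda>k. K\<^sup>2 * (cmod (x k))\<^sup>2)"
    using assms(1) by (intro summable_mult)
next
  fix k :: nat
  have "(cmod (y k))\<^sup>2 \<le> K\<^sup>2"
    using assms(2)[of k] by (intro power_mono) auto
  then show "norm ((cmod (y k * x k))\<^sup>2) \<le> K\<^sup>2 * (cmod (x k))\<^sup>2"
    by (simp add: norm_mult power_mult_distrib mult_right_mono)
qed

instantiation ell2 :: real_vector
begin

lift_definition zero_ell2 :: ell2 is "\<lambda>_. 0" by simp

lift_definition plus_ell2 :: "ell2 \<Rightarrow> ell2 \<Rightarrow> ell2" is "\<lambda>x y k. x k + y k"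
  by (rule summable_cmod_add_power2)

lift_definition uminus_ell2 :: "ell2 \<Rightarrow> ell2" is "\<lambda>x k. - x k" by simp

definition minus_ell2 :: "ell2 \<Rightarrow> ell2 \<Rightarrow> ell2" where "minus_ell2 x y = x + - y"

lift_definition scaleR_ell2 :: "real \<Rightarrow> ell2 \<Rightarrow> ell2" is "\<lambda>r x k. r *\<^sub>R x k"
  by (simp add: power_mult_distrib summable_mult)

instance
  by standard
    (simp_all add: minus_ell2_def, (transfer, simp add: fun_eq_iff algebra_simps)+)

end

instantiation ell2 :: real_normed_vector
begin

definition norm_ell2 :: "ell2 \<Rightarrow> real"
  where "norm_ell2 x = sqrt (\<Sum>k. (cmod (ell2_coord x k))\<^sup>2)"

definition dist_ell2 :: "ell2 \<Rightarrow> ell2 \<Rightarrow> real"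
  where "dist_ell2 x y = norm (x - y)"

definition sgn_ell2 :: "ell2 \<Rightarrow> ell2"
  where "sgn_ell2 x = x /\<^sub>R norm x"

definition uniformity_ell2 :: "(ell2 \<times> ell2) filter"
  where "uniformity_ell2 = (INF e\<in>{0 <..}. principal {(x, y). dist x y < e})"

definition open_ell2 :: "ell2 set \<Rightarrow> bool"
  where "open_ell2 S = (\<forall>x\<in>S. \<forall>\<^sub>F (x', y) in uniformity. x' = x \<longrightarrow> y \<in> S)"

lemma L2_set_le_norm_ell2: "L2_set (\<lambda>k. cmod (ell2_coord x k)) {..<n} \<le> norm x"
  unfolding L2_set_def norm_ell2_def
  by (intro real_sqrt_le_mono sum_le_suminf summable_ell2_coord) auto

instance
proof
  fix x y :: ell2 and r :: real
  show "norm x = 0 \<longleftrightarrow> x = 0"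
  proof -
    have "norm x = 0 \<longleftrightarrow> (\<forall>k. (cmod (ell2_coord x k))\<^sup>2 = 0)"
      unfolding norm_ell2_def real_sqrt_eq_zero_cancel_iff
      by (rule suminf_eq_zero_iff[OF summable_ell2_coord]) simp
    also have "\<dots> \<longleftrightarrow> x = 0"
      by (simp add: ell2_coord_inject[symmetric] zero_ell2.rep_eq fun_eq_iff)
    finally show ?thesis .
  qed
  show "norm (x + y) \<le> norm x + norm y"
  proof -
    have "(\<Sum>k. (cmod (ell2_coord (x + y) k))\<^sup>2) \<le> (norm x + norm y)\<^sup>2"
    proof (rule suminf_le_const[OF summable_ell2_coord])
      fix n :: nat
      have "L2_set (\<lambda>k. cmod (ell2_coord (x + y) k)) {..<n}
          \<le> L2_set (\<lambda>k. cmod (ell2_coord x k) + cmod (ell2_coord y k)) {..<n}"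
        by (intro L2_set_mono) (auto simp: plus_ell2.rep_eq norm_triangle_ineq)
      also have "\<dots> \<le> L2_set (\<lambda>k. cmod (ell2_coord x k)) {..<n} + L2_set (\<lambda>k. cmod (ell2_coord y k)) {..<n}"
        by (rule L2_set_triangle_ineq)
      also have "\<dots> \<le> norm x + norm y"
        by (intro add_mono L2_set_le_norm_ell2)
      finally have "(L2_set (\<lambda>k. cmod (ell2_coord (x + y) k)) {..<n})\<^sup>2 \<le> (norm x + norm y)\<^sup>2"
        by (intro power_mono) auto
      then show "(\<Sum>k<n. (cmod (ell2_coord (x + y) k))\<^sup>2) \<le> (norm x + norm y)\<^sup>2"
        by (simp add: L2_set_def sum_nonneg)
    qed
    moreover have "0 \<le> norm x + norm y"
      unfolding norm_ell2_def by (simp add: suminf_nonneg summable_ell2_coord)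
    ultimately show ?thesis
      unfolding norm_ell2_def[of "x + y"] by (rule real_le_lsqrt[rotated 1])
  qed
  show "norm (r *\<^sub>R x) = \<bar>r\<bar> * norm x"
    by (simp add: norm_ell2_def scaleR_ell2.rep_eq power_mult_distrib suminf_mult
        summable_ell2_coord real_sqrt_mult)
qed (simp_all add: dist_ell2_def sgn_ell2_def uniformity_ell2_def open_ell2_def)

end


section \<open>Infinite matrices and operators\<close>

text \<open>An infinite matrix \<open>M\<close> has rows and columns \<open>1, 2, \<dots>\<close>; entries with an index \<open>0\<close> are never used.\<close>

type_synonym imat = "nat \<Rightarrow> nat \<Rightarrow> complex"

definition imat_mult :: "imat \<Rightarrow> imat \<Rightarrow> imat" where
  "imat_mult M N i j = (\<Sum>k. M i (Suc k) * N (Suc k) j)"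

definition imat_commutator :: "imat \<Rightarrow> imat \<Rightarrow> imat" where
  "imat_commutator M N i j = imat_mult M N i j - imat_mult N M i j"

definition strictly_lower :: "imat \<Rightarrow> imat" where
  "strictly_lower M i j = (if j < i then M i j else 0)"

definition imat_scalar :: "complex \<Rightarrow> imat" where
  "imat_scalar z i j = (if i = j then z else 0)"

definition op_of_imat :: "imat \<Rightarrow> ell2 \<Rightarrow> ell2" where
  "op_of_imat M x = Abs_ell2 (\<lambda>k. \<Sum>l. M (Suc k) (Suc l) * ell2_coord x l)"

definition ell2_unit :: "nat \<Rightarrow> ell2" where
  "ell2_unit k = Abs_ell2 (\<lambda>l. if l = k then 1 else 0)"

lemma ell2_coord_ell2_unit: "ell2_coord (ell2_unit k) l = (if l = k then 1 else 0)"
proof -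
  have "summable (\<lambda>l. (cmod (if l = k then 1 else 0))\<^sup>2)"
    by (rule summable_finite[of "{k}"]) auto
  then show ?thesis
    unfolding ell2_unit_def by (subst Abs_ell2_inverse) auto
qed

definition imat_of_op :: "(ell2 \<Rightarrow> ell2) \<Rightarrow> imat" where
  "imat_of_op T i j = ell2_coord (T (ell2_unit (j - 1))) (i - 1)"

definition block :: "imat \<Rightarrow> nat \<Rightarrow> nat \<Rightarrow> complex^2^2" where
  "block M i j = vector [vector [M (2*i - 1) (2*j - 1), M (2*i - 1) (2*j)],
                         vector [M (2*i) (2*j - 1), M (2*i) (2*j)]]"


section \<open>The banded matrix, its resolvent and the generating function\<close>

text \<open>In everything that follows, \<open>a\<close>, \<open>b\<close>, \<open>c\<close> are families of functions of the time \<open>t\<close>, of which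
  only the members with index at least \<open>1\<close> are used.\<close>

type_synonym coeffs = "nat \<Rightarrow> real \<Rightarrow> complex"

definition Jmat :: "coeffs \<Rightarrow> coeffs \<Rightarrow> coeffs \<Rightarrow> real \<Rightarrow> imat" where
  "Jmat a b c t i j =
     (if j = i then a i t
      else if j = i + 1 then 1
      else if i = j + 1 then b j t
      else if i = j + 2 then c j t
      else 0)"

text \<open>With bounded coefficients, the matrix acts on \<open>ell2\<close> as expected.\<close>

lemma ell2_coord_op_Jmat:
  assumes "\<And>n. n \<ge> 1 \<Longrightarrow> cmod (a n t) \<le> K \<and> cmod (b n t) \<le> K \<and> cmod (c n t) \<le> K"
  shows "ell2_coord (op_of_imat (Jmat a b c t) x) k =
           a (k + 1) t * ell2_coord x k + ell2_coord x (k + 1)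
           + (if k \<ge> 1 then b k t * ell2_coord x (k - 1) else 0)
           + (if k \<ge> 2 then c (k - 1) t * ell2_coord x (k - 2) else 0)"
proof -
  define X where "X = ell2_coord x"
  define Y where "Y k = a (k + 1) t * X k + X (k + 1)
           + (if k \<ge> 1 then b k t * X (k - 1) else 0)
           + (if k \<ge> 2 then c (k - 1) t * X (k - 2) else 0)" for k
  have row: "(\<Sum>l. Jmat a b c t (Suc k) (Suc l) * X l) = Y k" for k
  proof -
    have "(\<Sum>l. Jmat a b c t (Suc k) (Suc l) * X l) = (\<Sum>l\<in>{k - 2..k + 1}. Jmat a b c t (Suc k) (Suc l) * X l)"
      by (rule suminf_finite) (auto simp: Jmat_def)
    also have "\<dots> = Y k"
    proof -
      consider "k = 0" | "k = 1" | m where "k = m + 2"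
        by (metis One_nat_def Suc_eq_plus1 add_2_eq_Suc' not0_implies_Suc)
      then show ?thesis
      proof cases
        case 1
        then show ?thesis by (simp add: Y_def Jmat_def)
      next
        case 2
        then have "{k - 2..k + 1} = {0, 1, 2}" by auto
        with 2 show ?thesis by (simp add: Y_def Jmat_def numeral_2_eq_2)
      next
        case 3
        then have "{k - 2..k + 1} = {m, m + 1, m + 2, m + 3}" by auto
        with 3 show ?thesis by (simp add: Y_def Jmat_def numeral_2_eq_2 numeral_3_eq_3)
      qed
    qed
    finally show ?thesis .
  qed
  have X: "summable (\<lambda>k. (cmod (X k))\<^sup>2)"
    unfolding X_def by (rule summable_ell2_coord)
  have K: "0 \<le> K"
    using assms[of 1] norm_ge_zero[of "a 1 t"] by linarith
  have "summable (\<lambda>k. (cmod (if k \<ge> m then X (k - m) else 0))\<^sup>2)" for m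
    by (subst summable_iff_shift[symmetric, of _ m]) (simp add: X)
  then have shift: "summable (\<lambda>k. (cmod (y k * (if k \<ge> m then X (k - m) else 0)))\<^sup>2)"
    if "\<And>k. cmod (y k) \<le> K" for m and y :: "nat \<Rightarrow> complex"
    using that by (rule summable_cmod_mult_power2)
  have "summable (\<lambda>k. (cmod (Y k))\<^sup>2)"
    unfolding Y_def
  proof (intro summable_cmod_add_power2)
    show "summable (\<lambda>k. (cmod (a (k + 1) t * X k))\<^sup>2)"
      by (rule summable_cmod_mult_power2[OF X]) (use assms in auto)
    show "summable (\<lambda>k. (cmod (X (k + 1)))\<^sup>2)"
      using X by (subst summable_iff_shift)
    have "summable (\<lambda>k. (cmod ((if k \<ge> 1 then b k t else 0) * (if k \<ge> 1 then X (k - 1) else 0)))\<^sup>2)"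
      by (rule shift) (use assms K in auto)
    then show "summable (\<lambda>k. (cmod (if k \<ge> 1 then b k t * X (k - 1) else 0))\<^sup>2)"
      by (rule summable_cong[THEN iffD1, rotated]) simp
    have "summable (\<lambda>k. (cmod ((if k \<ge> 2 then c (k - 1) t else 0) * (if k \<ge> 2 then X (k - 2) else 0)))\<^sup>2)"
      by (rule shift) (use assms K in auto)
    then show "summable (\<lambda>k. (cmod (if k \<ge> 2 then c (k - 1) t * X (k - 2) else 0))\<^sup>2)"
      by (rule summable_cong[THEN iffD1, rotated]) simp
  qed
  then have "ell2_coord (op_of_imat (Jmat a b c t) x) = Y"
    unfolding op_of_imat_def X_def[symmetric] row by (simp add: Abs_ell2_inverse)
  then show ?thesis
    by (simp add: Y_def X_def)
qed

definition Jnorm :: "coeffs \<Rightarrow> coeffs \<Rightarrow> coeffs \<Rightarrow> real \<Rightarrow> real" where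
  "Jnorm a b c t = onorm (op_of_imat (Jmat a b c t))"

definition resolvent11 :: "coeffs \<Rightarrow> coeffs \<Rightarrow> coeffs \<Rightarrow> real \<Rightarrow> complex \<Rightarrow> complex^2^2" where
  "resolvent11 a b c t z =
     block (imat_of_op (inv (op_of_imat (\<lambda>i j. imat_scalar z i j - Jmat a b c t i j)))) 1 1"

definition Cmat :: "coeffs \<Rightarrow> coeffs \<Rightarrow> coeffs \<Rightarrow> nat \<Rightarrow> real \<Rightarrow> complex^2^2" where
  "Cmat a b c n t =
     (if n = 0 then vector [vector [1, 0], vector [- a 1 t, 1]]
      else vector [vector [c (2*n - 1) t, b (2*n) t], vector [0, c (2*n) t]])"

definition Dmat :: "coeffs \<Rightarrow> nat \<Rightarrow> real \<Rightarrow> complex^2^2" where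
  "Dmat b n t = vector [vector [0, 0], vector [b (2*n + 1) t, 0]]"

definition genfun :: "coeffs \<Rightarrow> coeffs \<Rightarrow> coeffs \<Rightarrow> real \<Rightarrow> complex \<Rightarrow> complex^2^2" where
  "genfun a b c t \<zeta> = matrix_inv (Cmat a b c 0 t) ** resolvent11 a b c t \<zeta> ** Cmat a b c 0 t"


section \<open>The polynomials and the vectors of functionals\<close>

fun recP :: "coeffs \<Rightarrow> coeffs \<Rightarrow> coeffs \<Rightarrow> real \<Rightarrow> nat \<Rightarrow> complex poly" where
  "recP a b c t 0 = 1"
| "recP a b c t (Suc 0) = [:- a 1 t, 1:] * recP a b c t 0"
| "recP a b c t (Suc (Suc 0)) =
     [:- a 2 t, 1:] * recP a b c t (Suc 0) - smult (b 1 t) (recP a b c t 0)"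
| "recP a b c t (Suc (Suc (Suc n))) =
     [:- a (n + 3) t, 1:] * recP a b c t (Suc (Suc n))
     - smult (b (n + 2) t) (recP a b c t (Suc n)) - smult (c (n + 1) t) (recP a b c t n)"

lemma recP_rec:
  "(if n \<ge> 2 then smult (c (n - 1) t) (recP a b c t (n - 2)) else 0)
   + (if n \<ge> 1 then smult (b n t) (recP a b c t (n - 1)) else 0)
   + [:a (n + 1) t, - 1:] * recP a b c t n + recP a b c t (n + 1) = 0"
proof -
  have neg: "[:a m t, - 1:] * p = - ([:- a m t, 1:] * p)" for m p
    by (simp add: minus_mult_left)
  consider "n = 0" | "n = 1" | m where "n = m + 2"
    by (metis One_nat_def Suc_eq_plus1 add_2_eq_Suc' not0_implies_Suc)
  then show ?thesis
  proof cases
    case 1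
    then show ?thesis unfolding neg by simp
  next
    case 2
    then show ?thesis unfolding neg by (simp add: numeral_2_eq_2)
  next
    case 3
    have e: "recP a b c t (n + 1) = [:- a (Suc (Suc (Suc m))) t, 1:] * recP a b c t (m + 2)
       - smult (b (m + 2) t) (recP a b c t (m + 1)) - smult (c (m + 1) t) (recP a b c t m)"
      unfolding 3 using recP.simps(4)[of a b c t m] by (simp add: numeral_2_eq_2 numeral_3_eq_3 del: recP.simps mult_pCons_left)
    have "n + 1 = m + 3" "n - 1 = m + 1" "n - 2 = m" "n \<ge> 2" "n \<ge> 1"
      using 3 by auto
    then show ?thesis unfolding neg e by (simp add: 3 del: mult_pCons_left)
  qed
qed

text \<open>The vector with polynomial entries and index \<open>-1\<close> is zero, hence the integer index.\<close>

definition Bvec :: "coeffs \<Rightarrow> coeffs \<Rightarrow> coeffs \<Rightarrow> real \<Rightarrow> int \<Rightarrow> complex poly^2" where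
  "Bvec a b c t m =
     (if m < 0 then 0
      else vector [recP a b c t (2 * nat m), recP a b c t (2 * nat m + 1)])"

definition poly_vec :: "complex poly^2 \<Rightarrow> complex \<Rightarrow> complex^2" where
  "poly_vec Q z = (\<chi> i. poly (Q $ i) z)"

definition Pvec :: "nat \<Rightarrow> complex poly^2" where
  "Pvec m = vector [monom 1 (2*m), monom 1 (2*m + 1)]"

definition vector_of_functionals ::
    "coeffs \<Rightarrow> coeffs \<Rightarrow> coeffs \<Rightarrow> real \<Rightarrow> (complex poly^2 \<Rightarrow> complex^2^2) \<Rightarrow> bool" where
  "vector_of_functionals a b c t W \<longleftrightarrow>
     (\<exists>u1 u2 :: complex poly \<Rightarrow> complex.
        Vector_Spaces.linear smult (*) u1 \<and> Vector_Spaces.linear smult (*) u2 \<and>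
        (\<forall>Q. W Q = vector [vector [u1 (Q $ 1), u2 (Q $ 1)], vector [u1 (Q $ 2), u2 (Q $ 2)]]) \<and>
        (\<forall>m\<ge>1. \<forall>u\<in>{u1, u2}. \<forall>j<m.
           u (monom 1 j * recP a b c t (2*m)) = 0 \<and> u (monom 1 j * recP a b c t (2*m + 1)) = 0) \<and>
        (\<forall>m\<ge>1. u1 (monom 1 m * recP a b c t (2*m + 1)) = 0))"

definition right_mult_functional ::
    "(complex poly^2 \<Rightarrow> complex^2^2) \<Rightarrow> complex^2^2 \<Rightarrow> complex poly^2 \<Rightarrow> complex^2^2" where
  "right_mult_functional W M Q = W Q ** M"

end

theory Submission
  imports Defs
begin

text \<open>Let \<open>x\<^sub>n\<close> be the first row of \<open>J\<^sup>n\<close>. The functionals of \<open>U\<close> vanish on \<open>P\<^sub>k\<close> for \<open>k \<ge> 2\<close>, so that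
  the moments \<open>U (z\<^sup>n P\<^sub>0) = C\<^sub>0\<^sup>-\<^sup>1 (J\<^sup>n)\<^sub>1\<^sub>1 C\<^sub>0\<close> depend only on the first two entries of the rows \<open>x\<^sub>n\<close>, and
  the moment equations say that \<open>x\<^sub>n' = x\<^sub>n J\<^sub>-\<close> holds in the first two columns. The Lax equation gives
  \<open>(J\<^sup>n)' = [J\<^sup>n, J\<^sub>-]\<close>, whose first row is \<open>x\<^sub>n' = x\<^sub>n J\<^sub>-\<close>. Conversely, \<open>d\<^sub>n = x\<^sub>n' - x\<^sub>n J\<^sub>-\<close> satisfies
  \<open>d\<^sub>n\<^sub>+\<^sub>1 = d\<^sub>n J + x\<^sub>n (J' - [J, J\<^sub>-])\<close>; if its columns up to \<open>k + 1\<close> vanish for all \<open>n\<close>, then evaluation at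
  \<open>n = k, k + 1, k + 2\<close>, where \<open>x\<^sub>n\<close> is unitriangular, kills column \<open>k\<close> of the defect \<open>J' - [J, J\<^sub>-]\<close>, and
  \<open>c\<^sub>k\<^sub>+\<^sub>1 \<noteq> 0\<close> then kills column \<open>k + 2\<close> of \<open>d\<^sub>n\<close> (columns counted from \<open>0\<close>).\<close>

section \<open>Componentwise derivatives\<close>

lemma has_vector_derivative_vec_iff:
  fixes f :: "real \<Rightarrow> ('b::real_normed_vector)^'n"
  shows "(f has_vector_derivative f') (at t within S) \<longleftrightarrow>
    (\<forall>i. ((\<lambda>s. f s $ i) has_vector_derivative f' $ i) (at t within S))"
proof
  assume "(f has_vector_derivative f') (at t within S)"
  then show "\<forall>i. ((\<lambda>s. f s $ i) has_vector_derivative f' $ i) (at t within S)"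
    by (auto intro: bounded_linear.has_vector_derivative[OF bounded_linear_vec_nth])
next
  assume comp: "\<forall>i. ((\<lambda>s. f s $ i) has_vector_derivative f' $ i) (at t within S)"
  show "(f has_vector_derivative f') (at t within S)"
    unfolding has_vector_derivative_def has_derivative_within
  proof (intro conjI bounded_linear_scaleR_left vec_tendstoI)
    fix i
    show "((\<lambda>y. ((1 / norm (y - t)) *\<^sub>R (f y - (f t + (y - t) *\<^sub>R f'))) $ i) \<longlongrightarrow> 0 $ i) (at t within S)"
      using comp[rule_format, of i]
      by (simp add: has_vector_derivative_def has_derivative_within)
  qed
qed

lemma has_vector_derivative_matrix2_iff:
  fixes f :: "real \<Rightarrow> ('b::real_normed_vector)^2^2"
  shows "(f has_vector_derivative f') (at t within S) \<longleftrightarrow>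
    (\<forall>i j. ((\<lambda>s. f s $ i $ j) has_vector_derivative f' $ i $ j) (at t within S))"
  by (simp add: has_vector_derivative_vec_iff)

lemma matrix_inv_left: "invertible A \<Longrightarrow> matrix_inv A ** A = mat 1"
  and matrix_inv_right: "invertible A \<Longrightarrow> A ** matrix_inv A = mat 1"
  unfolding invertible_def matrix_inv_def by (metis (mono_tags, lifting) someI_ex)+

section \<open>The first row of the powers of the matrix\<close>

text \<open>At \<open>n = 1\<close> the system refers to \<open>b 0\<close> and \<open>c 0\<close>;
  their vanishing is supplied separately by the lemmas that use the system.\<close>

definition toda_system :: "coeffs \<Rightarrow> coeffs \<Rightarrow> coeffs \<Rightarrow> bool" where
  "toda_system a b c \<longleftrightarrow> (\<forall>n\<ge>1. \<forall>t.
      (a n has_vector_derivative b n t - b (n - 1) t) (at t) \<and>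
      (b n has_vector_derivative b n t * (a (n + 1) t - a n t) + c n t - c (n - 1) t) (at t) \<and>
      (c n has_vector_derivative c n t * (a (n + 2) t - a n t)) (at t))"

text \<open>\<open>jrow a b c t n k\<close> is the entry of \<open>J\<^sup>n\<close> in row \<open>1\<close> and column \<open>k + 1\<close>.\<close>

fun jrow :: "coeffs \<Rightarrow> coeffs \<Rightarrow> coeffs \<Rightarrow> real \<Rightarrow> nat \<Rightarrow> nat \<Rightarrow> complex" where
  "jrow a b c t 0 k = (if k = 0 then 1 else 0)"
| "jrow a b c t (Suc n) k = (if k = 0 then 0 else jrow a b c t n (k - 1))
     + a (k + 1) t * jrow a b c t n k + b (k + 1) t * jrow a b c t n (k + 1)
     + c (k + 1) t * jrow a b c t n (k + 2)"

text \<open>Above its diagonal J has only the ones of the superdiagonal. So each multiplication by J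
  extends the support of the row by one column, and the new last entry is again 1.\<close>

lemma jrow_eq_0: "n < k \<Longrightarrow> jrow a b c t n k = 0"
  by (induction n arbitrary: k) auto

lemma jrow_diag: "jrow a b c t n n = 1"
  by (induction n) (auto simp: jrow_eq_0)

lemma jrow_differentiable:
  assumes "\<forall>n\<ge>1. \<forall>t. a n differentiable (at t) \<and> b n differentiable (at t) \<and> c n differentiable (at t)"
  shows "(\<lambda>s. jrow a b c s n k) differentiable (at t)"
proof (induction n arbitrary: k)
  case (Suc n)
  have "(\<lambda>s. if k = 0 then 0 else jrow a b c s n (k - 1)) differentiable (at t)"
    using Suc by (cases k) auto
  then show ?case
    unfolding jrow.simps using Suc assms
    by (intro differentiable_add differentiable_mult) auto
qed simp

text \<open>In matrix form, \<open>row_flow\<close> says that column \<open>k + 1\<close> of the first row of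
  \<open>(J\<^sup>n)' - J\<^sup>n J\<^sub>-\<close> vanishes.\<close>

definition row_flow :: "coeffs \<Rightarrow> coeffs \<Rightarrow> coeffs \<Rightarrow> nat \<Rightarrow> bool" where
  "row_flow a b c k \<longleftrightarrow> (\<forall>n t. ((\<lambda>s. jrow a b c s n k) has_vector_derivative
     b (k + 1) t * jrow a b c t n (k + 1) + c (k + 1) t * jrow a b c t n (k + 2)) (at t))"

text \<open>Induction on the power: differentiating \<open>x_{n+1} = x_n J\<close> gives
  \<open>x_n J_- J + x_n (J J_- - J_- J)\<close>, which is \<open>x_{n+1} J_-\<close>.\<close>

lemma toda_system_imp_row_flow:
  assumes E: "toda_system a b c" and b0: "\<And>t. b 0 t = 0" and c0: "\<And>t. c 0 t = 0"
  shows "row_flow a b c k"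
proof -
  have "((\<lambda>s. jrow a b c s n k) has_vector_derivative
     b (k + 1) t * jrow a b c t n (k + 1) + c (k + 1) t * jrow a b c t n (k + 2)) (at t)" for n t
  proof (induction n arbitrary: k)
    case (Suc n)
    \<comment> \<open>For \<open>k = 0\<close> there is no preceding column, and the stated
      derivative is 0 because \<open>b 0\<close> and \<open>c 0\<close> vanish. The computation
      below is thus uniform in \<open>k\<close>.\<close>
    have prev: "((\<lambda>s. if k = 0 then 0 else jrow a b c s n (k - 1)) has_vector_derivative
        b k t * jrow a b c t n k + c k t * jrow a b c t n (k + 1)) (at t)"
    proof (cases k)
      case (Suc m)
      then show ?thesis using Suc.IH[of m] by simp
    qed (simp add: b0 c0)
    have abc: "(a (k + 1) has_vector_derivative b (k + 1) t - b k t) (at t)"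
      "(b (k + 1) has_vector_derivative
          b (k + 1) t * (a (k + 2) t - a (k + 1) t) + c (k + 1) t - c k t) (at t)"
      "(c (k + 1) has_vector_derivative c (k + 1) t * (a (k + 3) t - a (k + 1) t)) (at t)"
      using E[unfolded toda_system_def, rule_format, of "k + 1" t] by (simp_all add: numeral_3_eq_3)
    show ?case
      unfolding jrow.simps(2)[of a b c _ n k]
      by (rule has_vector_derivative_eq_rhs, (rule has_vector_derivative_add has_vector_derivative_mult
          prev abc Suc.IH)+)
        (simp add: algebra_simps numeral_3_eq_3)
  qed simp
  then show ?thesis by (simp add: row_flow_def)
qed

lemma row_flow_imp_toda_system:
  assumes diff: "\<forall>n\<ge>1. \<forall>t. a n differentiable (at t) \<and> b n differentiable (at t) \<and> c n differentiable (at t)"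
    and nonzero: "\<forall>n\<ge>1. \<forall>t. c n t \<noteq> 0"
    and b0: "\<And>t. b 0 t = 0" and c0: "\<And>t. c 0 t = 0"
    and flow: "row_flow a b c 0" "row_flow a b c 1"
  shows "toda_system a b c"
  unfolding toda_system_def
proof (intro allI impI)
  fix N :: nat and t :: real
  assume "N \<ge> 1"
  define x where "x = jrow a b c t"
  define d where "d n k = vector_derivative (\<lambda>s. jrow a b c s n k) (at t)
    - (b (k + 1) t * x n (k + 1) + c (k + 1) t * x n (k + 2))" for n k
  \<comment> \<open>These are the entries of column \<open>k\<close> (counted from 0) of the defect
    J' - [J, J_-] on the diagonal and on the first and second subdiagonal.\<close>
  define \<alpha> where "\<alpha> k = vector_derivative (a (k + 1)) (at t) - (b (k + 1) t - b k t)" for k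
  define \<beta> where "\<beta> k = vector_derivative (b (k + 1)) (at t)
    - (b (k + 1) t * (a (k + 2) t - a (k + 1) t) + c (k + 1) t - c k t)" for k
  define \<gamma> where "\<gamma> k = vector_derivative (c (k + 1)) (at t)
    - c (k + 1) t * (a (k + 3) t - a (k + 1) t)" for k
  have x': "((\<lambda>s. jrow a b c s n k) has_vector_derivative
      d n k + (b (k + 1) t * x n (k + 1) + c (k + 1) t * x n (k + 2))) (at t)" for n k
    using jrow_differentiable[OF diff] by (simp add: d_def vector_derivative_works)
  have abc': "(a (k + 1) has_vector_derivative \<alpha> k + (b (k + 1) t - b k t)) (at t)"
    "(b (k + 1) has_vector_derivative
        \<beta> k + (b (k + 1) t * (a (k + 2) t - a (k + 1) t) + c (k + 1) t - c k t)) (at t)"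
    "(c (k + 1) has_vector_derivative \<gamma> k + c (k + 1) t * (a (k + 3) t - a (k + 1) t)) (at t)" for k
    using diff by (simp_all add: \<alpha>_def \<beta>_def \<gamma>_def vector_derivative_works)
  \<comment> \<open>The derivative of \<open>x_{n+1} = x_n J\<close> by the product rule is compared
    with the one that defines \<open>d (Suc n) k\<close>.\<close>
  have d_Suc: "d (Suc n) k = (if k = 0 then 0 else d n (k - 1)) + a (k + 1) t * d n k
      + b (k + 1) t * d n (k + 1) + c (k + 1) t * d n (k + 2)
      + x n k * \<alpha> k + x n (k + 1) * \<beta> k + x n (k + 2) * \<gamma> k" for n k
  proof -
    have prev: "((\<lambda>s. if k = 0 then 0 else jrow a b c s n (k - 1)) has_vector_derivative
        (if k = 0 then 0 else d n (k - 1)) + (b k t * x n k + c k t * x n (k + 1))) (at t)"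
    proof (cases k)
      case (Suc m)
      then show ?thesis using x'[of n m] by simp
    qed (simp add: b0 c0)
    have "((\<lambda>s. jrow a b c s (Suc n) k) has_vector_derivative
      (if k = 0 then 0 else d n (k - 1)) + a (k + 1) t * d n k
      + b (k + 1) t * d n (k + 1) + c (k + 1) t * d n (k + 2)
      + x n k * \<alpha> k + x n (k + 1) * \<beta> k + x n (k + 2) * \<gamma> k +
      (b (k + 1) t * x (Suc n) (k + 1) + c (k + 1) t * x (Suc n) (k + 2))) (at t)"
      unfolding jrow.simps(2)[of a b c _ n k]
      by (rule has_vector_derivative_eq_rhs, (rule has_vector_derivative_add has_vector_derivative_mult
          prev abc' x')+)
        (simp add: x_def algebra_simps numeral_3_eq_3)
    from vector_derivative_unique_at[OF this x'] show ?thesis by simp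
  qed
  \<comment> \<open>For \<open>n \<le> k\<close> the entry is constantly 0 or 1, and the entries
    further right in the same row vanish.\<close>
  have d_upper: "d n k = 0" if "n \<le> k" for n k
  proof -
    have "(\<lambda>s. jrow a b c s n k) = (\<lambda>s. if n = k then 1 else 0)"
      using that by (auto simp: jrow_eq_0 jrow_diag)
    then show ?thesis using that by (simp add: d_def x_def jrow_eq_0)
  qed
  have step: "\<alpha> k = 0 \<and> \<beta> k = 0 \<and> \<gamma> k = 0 \<and> (\<forall>n. d n (k + 2) = 0)"
    if "\<And>n j. j \<le> k + 1 \<Longrightarrow> d n j = 0" for k
  proof -
    \<comment> \<open>All other terms of \<open>d_Suc\<close> lie in columns up to
      \<open>k + 1\<close>. For \<open>n = k, k + 1, k + 2\<close> the first summand vanishes by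
      \<open>d_upper\<close>, so a triangular system for the three defects remains.\<close>
    have eq: "c (k + 1) t * d n (k + 2) + x n k * \<alpha> k + x n (k + 1) * \<beta> k + x n (k + 2) * \<gamma> k = 0" for n
      using d_Suc[of n k] that[of n "k - 1"] that by (simp split: if_splits)
    have "\<alpha> k = 0" using eq[of k] by (simp add: x_def jrow_eq_0 jrow_diag d_upper)
    moreover from this have "\<beta> k = 0"
      using eq[of "k + 1"] jrow_diag[of a b c t "k + 1"] by (simp add: x_def jrow_eq_0 d_upper del: jrow.simps)
    moreover from calculation have "\<gamma> k = 0"
      using eq[of "k + 2"] jrow_diag[of a b c t "k + 2"] by (simp add: x_def jrow_eq_0 d_upper del: jrow.simps)
    ultimately show ?thesis using eq nonzero by auto
  qed
  have d01: "d n 0 = 0" "d n 1 = 0" for n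
    using flow[unfolded row_flow_def, rule_format, of n t] vector_derivative_at
    by (fastforce simp: d_def x_def)+
  have d0: "d n k = 0" for n k
  proof (induction k arbitrary: n rule: less_induct)
    case (less k)
    show ?case
    proof (cases "k \<le> 1")
      case False
      then have "\<forall>n. d n (k - 2 + 2) = 0"
        using less.IH by (intro step[of "k - 2", THEN conjunct2, THEN conjunct2, THEN conjunct2]) auto
      moreover have "k - 2 + 2 = k" using False by simp
      ultimately show ?thesis by metis
    qed (use d01 in \<open>auto simp: le_Suc_eq\<close>)
  qed
  obtain k where "N = k + 1" using \<open>N \<ge> 1\<close> by (metis le_add_diff_inverse2)
  then show "(a N has_vector_derivative b N t - b (N - 1) t) (at t) \<and>
      (b N has_vector_derivative b N t * (a (N + 1) t - a N t) + c N t - c (N - 1) t) (at t) \<and>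
      (c N has_vector_derivative c N t * (a (N + 2) t - a N t)) (at t)"
    using abc'[of k] step[of k] d0 by (simp add: numeral_3_eq_3)
qed

section \<open>The polynomials\<close>


text \<open>One formula for all \<open>k\<close>: where truncated subtraction produces a wrong
  index, its coefficient is \<open>b 0\<close> or \<open>c 0\<close>, hence zero.\<close>

lemma recP_Suc:
  assumes "b 0 t = 0" and "c 0 t = 0"
  shows "recP a b c t (Suc k) = [:- a (k + 1) t, 1:] * recP a b c t k
     - smult (b k t) (recP a b c t (k - 1)) - smult (c (k - 1) t) (recP a b c t (k - 2))"
proof -
  consider "k = 0" | "k = 1" | m where "k = Suc (Suc m)"
    by (metis One_nat_def not0_implies_Suc)
  then show ?thesis
    by cases (simp_all add: assms numeral_2_eq_2 numeral_3_eq_3 del: mult_pCons_left)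
qed

lemma coeff_recP:
  "coeff (recP a b c t n) n = 1 \<and> (\<forall>m>n. coeff (recP a b c t n) m = 0)"
proof (induction n rule: less_induct)
  case (less n)
  consider "n = 0" | "n = 1" | "n = 2" | m where "n = Suc (Suc (Suc m))"
    by (metis One_nat_def not0_implies_Suc numeral_2_eq_2)
  then show ?case
  proof cases
    case 3
    then show ?thesis using less.IH[of 1]
      by (auto simp: numeral_2_eq_2 coeff_pCons split: nat.splits)
  next
    case (4 m)
    then show ?thesis using less.IH[of m] less.IH[of "Suc m"] less.IH[of "Suc (Suc m)"]
      by (auto simp: coeff_pCons split: nat.splits)
  qed (auto simp: coeff_pCons split: nat.splits)
qed

text \<open>The polynomials are monic of distinct degrees, so comparing the coefficients at
  \<open>k\<close>, \<open>k - 1\<close>, \<open>k - 2\<close> in turn isolates the three scalars.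
  The guards exclude the small \<open>k\<close> for which truncated subtraction would repeat a
  polynomial.\<close>

lemma recP_independent:
  assumes "smult \<alpha> (recP a b c t k) + smult \<beta> (if k \<ge> 1 then recP a b c t (k - 1) else 0)
     + smult \<gamma> (if k \<ge> 2 then recP a b c t (k - 2) else 0) = 0" (is "?p = 0")
  shows "\<alpha> = 0" and "k \<ge> 1 \<Longrightarrow> \<beta> = 0" and "k \<ge> 2 \<Longrightarrow> \<gamma> = 0"
proof -
  show "\<alpha> = 0"
    using arg_cong[OF assms, of "\<lambda>p. coeff p k"] by (auto simp: coeff_recP split: if_splits)
  show "\<beta> = 0" if "k \<ge> 1"
    using arg_cong[OF assms, of "\<lambda>p. coeff p (k - 1)"] that \<open>\<alpha> = 0\<close>
    by (auto simp: coeff_recP split: if_splits)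
  then show "\<gamma> = 0" if "k \<ge> 2"
    using arg_cong[OF assms, of "\<lambda>p. coeff p (k - 2)"] that \<open>\<alpha> = 0\<close>
    by (auto simp: coeff_recP split: if_splits)
qed

text \<open>The left side is the time derivative of the recurrence for \<open>p (Suc k)\<close> when
  earlier polynomials move with velocity \<open>- N\<close>. It differs from the desired
  \<open>- N (Suc k)\<close> by the defects of the system, paired with three consecutive
  polynomials.\<close>

lemma recP_flow_defect:
  fixes p :: "nat \<Rightarrow> complex"
  assumes rec: "\<And>k. p (Suc k) = (z - a (k + 1)) * p k - b k * p (k - 1) - c (k - 1) * p (k - 2)"
    and 0: "b 0 = 0" "c 0 = 0" "b' 0 = 0" "c' 0 = 0"
  defines "N \<equiv> \<lambda>k. b k * p (k - 1) + c (k - 1) * p (k - 2)"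
  shows "- a' (k + 1) * p k - (z - a (k + 1)) * N k - b' k * p (k - 1) + b k * N (k - 1)
      - c' (k - 1) * p (k - 2) + c (k - 1) * N (k - 2) =
    - N (Suc k) - ((a' (k + 1) - (b (k + 1) - b k)) * p k
      + (b' k - (b k * (a (k + 1) - a k) + c k - c (k - 1))) * p (k - 1)
      + (c' (k - 1) - c (k - 1) * (a (k + 1) - a (k - 1))) * p (k - 2))"
proof -
  consider "k = 0" | "k = 1" | m where "k = m + 2"
    by (metis One_nat_def Suc_eq_plus1 add_2_eq_Suc' not0_implies_Suc)
  then show ?thesis
  proof cases
    case 1
    then show ?thesis by (simp add: N_def 0 algebra_simps)
  next
    case 2
    have p1: "p (Suc 0) = (z - a 1) * p 0" using rec[of 0] by (simp add: 0)
    show ?thesis by (simp add: 2 N_def 0 numeral_2_eq_2 p1 algebra_simps)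
  next
    case (3 m)
    \<comment> \<open>Multiplication by \<open>z\<close> is eliminated through the recurrence, after
      which both sides are combinations of the \<open>p\<close> with coefficients free of
      \<open>z\<close>.\<close>
    have r: "z * p (Suc m) = p (m + 2) + a (m + 2) * p (m + 1) + b (m + 1) * p m + c m * p (m - 1)"
      using rec[of "Suc m"] by (simp add: algebra_simps)
    have r': "z * p m = p (m + 1) + a (m + 1) * p m + b m * p (m - 1) + c (m - 1) * p (m - 2)"
      using rec[of m] by (simp add: algebra_simps)
    have "(z - a (k + 1)) * N k = b (m + 2) * (z * p (Suc m)) + c (m + 1) * (z * p m) - a (k + 1) * N k"
      by (simp add: N_def 3 algebra_simps)
    then show ?thesis
      unfolding r r' by (simp add: N_def 3 algebra_simps numeral_2_eq_2 numeral_3_eq_3)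
  qed
qed

text \<open>Both directions rest on \<open>step\<close>. If the defects vanish, it propagates the
  flow from lower indices to \<open>Suc k\<close>. If the flow holds, uniqueness of the derivative
  makes the residual vanish for every \<open>z\<close>, and linear independence forces the defects
  to be zero.\<close>

lemma toda_system_iff_recP_flow:
  assumes diff: "\<forall>n\<ge>1. \<forall>t. a n differentiable (at t) \<and> b n differentiable (at t) \<and> c n differentiable (at t)"
    and b0: "\<And>t. b 0 t = 0" and c0: "\<And>t. c 0 t = 0"
  shows "toda_system a b c \<longleftrightarrow> (\<forall>k z t. ((\<lambda>s. poly (recP a b c s k) z) has_vector_derivative
     - (b k t * poly (recP a b c t (k - 1)) z + c (k - 1) t * poly (recP a b c t (k - 2)) z)) (at t))"
    (is "_ \<longleftrightarrow> (\<forall>k z t. ?flow k z t)")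
proof -
  define p where "p t z k = poly (recP a b c t k) z" for t z k
  define a' where "a' t n = vector_derivative (a n) (at t)" for n t
  define b' where "b' t n = vector_derivative (b n) (at t)" for n t
  define c' where "c' t n = vector_derivative (c n) (at t)" for n t
  \<comment> \<open>Here the defects are grouped by row \<open>k + 1\<close> of J' - [J, J_-], so
    \<open>\<beta> t k\<close> belongs to \<open>b k\<close> and \<open>\<gamma> t k\<close> to
    \<open>c (k - 1)\<close>.\<close>
  define \<alpha> where "\<alpha> t k = a' t (k + 1) - (b (k + 1) t - b k t)" for t k
  define \<beta> where "\<beta> t k = b' t k - (b k t * (a (k + 1) t - a k t) + c k t - c (k - 1) t)" for t k
  define \<gamma> where "\<gamma> t k = c' t (k - 1) - c (k - 1) t * (a (k + 1) t - a (k - 1) t)" for t k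
  define N where "N t z k = b k t * p t z (k - 1) + c (k - 1) t * p t z (k - 2)" for t z k
  have zero: "b 0 = (\<lambda>_. 0)" "c 0 = (\<lambda>_. 0)" using b0 c0 by auto
  have a': "(a (k + 1) has_vector_derivative a' t (k + 1)) (at t)" for k t
    using diff by (simp add: a'_def vector_derivative_works)
  have b': "(b k has_vector_derivative b' t k) (at t)" for k t
    using diff by (cases k) (simp_all add: b'_def vector_derivative_works zero)
  have c': "(c k has_vector_derivative c' t k) (at t)" for k t
    using diff by (cases k) (simp_all add: c'_def vector_derivative_works zero)
  have p_Suc: "p t z (Suc k) = (z - a (k + 1) t) * p t z k - b k t * p t z (k - 1) - c (k - 1) t * p t z (k - 2)"
    for t z k
    using recP_Suc[where a = a and b = b and c = c and t = t and k = k, OF b0 c0] by (simp add: p_def del: mult_pCons_left)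
  have step: "((\<lambda>s. p s z (Suc k)) has_vector_derivative
      - N t z (Suc k) - (\<alpha> t k * p t z k + \<beta> t k * p t z (k - 1) + \<gamma> t k * p t z (k - 2))) (at t)"
    if "\<And>j. j \<le> k \<Longrightarrow> ((\<lambda>s. p s z j) has_vector_derivative - N t z j) (at t)" for k z t
  proof -
    have "((\<lambda>s. p s z (Suc k)) has_vector_derivative
      - a' t (k + 1) * p t z k - (z - a (k + 1) t) * N t z k - b' t k * p t z (k - 1) + b k t * N t z (k - 1)
      - c' t (k - 1) * p t z (k - 2) + c (k - 1) t * N t z (k - 2)) (at t)"
      unfolding p_Suc
      by (rule has_vector_derivative_eq_rhs, (rule has_vector_derivative_diff has_vector_derivative_mult
          has_vector_derivative_const a' b' c' that order_refl diff_le_self)+)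
        (simp add: algebra_simps)
    moreover have "b' t 0 = 0" "c' t 0 = 0" by (simp_all add: b'_def c'_def zero)
    ultimately show ?thesis
      using recP_flow_defect[where p = "p t z" and z = z and a = "\<lambda>n. a n t" and b = "\<lambda>n. b n t"
          and c = "\<lambda>n. c n t" and a' = "a' t" and b' = "b' t" and c' = "c' t" and k = k,
          OF p_Suc b0 c0]
      by (simp add: \<alpha>_def \<beta>_def \<gamma>_def N_def)
  qed
  have E_iff: "toda_system a b c \<longleftrightarrow> (\<forall>t k. \<alpha> t k = 0 \<and> \<beta> t k = 0 \<and> \<gamma> t k = 0)"
  proof
    assume E: "toda_system a b c"
    show "\<forall>t k. \<alpha> t k = 0 \<and> \<beta> t k = 0 \<and> \<gamma> t k = 0"
    proof (intro allI conjI)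
      fix t k
      note E' = E[unfolded toda_system_def, rule_format]
      show "\<alpha> t k = 0"
        using E'[of "k + 1" t, THEN conjunct1, THEN vector_derivative_at] by (simp add: \<alpha>_def a'_def)
      show "\<beta> t k = 0"
      proof (cases "k = 0")
        case False
        then show ?thesis
          using E'[of k t, THEN conjunct2, THEN conjunct1, THEN vector_derivative_at]
          by (simp add: \<beta>_def b'_def)
      qed (simp add: \<beta>_def b'_def zero)
      show "\<gamma> t k = 0"
      proof (cases "k \<le> 1")
        case False
        then have "k - 1 + 2 = k + 1" "k - 1 \<ge> 1" by simp_all
        then show ?thesis
          using E'[of "k - 1" t, THEN conjunct2, THEN conjunct2, THEN vector_derivative_at]
          by (simp add: \<gamma>_def c'_def)
      next
        case True
        then have "k - 1 = 0" by simp
        then show ?thesis by (simp only: \<gamma>_def c'_def zero) simp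
      qed
    qed
  next
    assume 0: "\<forall>t k. \<alpha> t k = 0 \<and> \<beta> t k = 0 \<and> \<gamma> t k = 0"
    show "toda_system a b c"
      unfolding toda_system_def
    proof (intro allI impI)
      fix n :: nat and t assume "n \<ge> 1"
      have "a' t n = b n t - b (n - 1) t"
        using 0[rule_format, of t "n - 1"] \<open>n \<ge> 1\<close> by (simp add: \<alpha>_def)
      moreover have "b' t n = b n t * (a (n + 1) t - a n t) + c n t - c (n - 1) t"
        using 0[rule_format, of t n] by (simp add: \<beta>_def)
      moreover have "c' t n = c n t * (a (n + 2) t - a n t)"
        using 0[rule_format, of t "n + 1"] by (simp add: \<gamma>_def)
      ultimately show "(a n has_vector_derivative b n t - b (n - 1) t) (at t) \<and>
        (b n has_vector_derivative b n t * (a (n + 1) t - a n t) + c n t - c (n - 1) t) (at t) \<and>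
        (c n has_vector_derivative c n t * (a (n + 2) t - a n t)) (at t)"
        using a'[of "n - 1" t] b'[of n t] c'[of n t] \<open>n \<ge> 1\<close> by simp
    qed
  qed
  show ?thesis
  proof
    assume "toda_system a b c"
    then have 0: "\<alpha> t k = 0" "\<beta> t k = 0" "\<gamma> t k = 0" for t k
      using E_iff by auto
    have "((\<lambda>s. p s z k) has_vector_derivative - N t z k) (at t)" for k z t
    proof (induction k rule: less_induct)
      case (less k)
      show ?case
      proof (cases k)
        case 0
        then show ?thesis using b0 c0 by (simp add: p_def N_def)
      next
        case (Suc m)
        then show ?thesis using step[of m z t] less.IH 0 by simp
      qed
    qed
    then show "\<forall>k z t. ?flow k z t" by (simp add: p_def N_def)
  next
    assume "\<forall>k z t. ?flow k z t"
    then have flow: "((\<lambda>s. p s z k) has_vector_derivative - N t z k) (at t)" for k z t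
      by (simp add: p_def N_def)
    have "\<alpha> t k = 0 \<and> \<beta> t k = 0 \<and> \<gamma> t k = 0" for t k
    proof -
      \<comment> \<open>For small \<open>k\<close> these defects refer to \<open>b 0\<close> and
        \<open>c 0\<close> and vanish identically; independence of the polynomials gives no
        information on them.\<close>
      have b00: "k = 0 \<Longrightarrow> \<beta> t k = 0" by (simp add: \<beta>_def b'_def zero)
      have c00: "k < 2 \<Longrightarrow> \<gamma> t k = 0"
      proof -
        assume "k < 2"
        then have "k - 1 = 0" by simp
        then show ?thesis by (simp only: \<gamma>_def c'_def zero) simp
      qed
      have cancel: "x - y = x \<Longrightarrow> y = 0" for x y :: complex by simp
      have "\<alpha> t k * p t z k + \<beta> t k * p t z (k - 1) + \<gamma> t k * p t z (k - 2) = 0" for z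
        by (rule cancel[OF vector_derivative_unique_at[OF step[of k z t, OF flow] flow[of z "Suc k" t]]])
      then have "\<forall>z. poly (smult (\<alpha> t k) (recP a b c t k)
          + smult (\<beta> t k) (if k \<ge> 1 then recP a b c t (k - 1) else 0)
          + smult (\<gamma> t k) (if k \<ge> 2 then recP a b c t (k - 2) else 0)) z = 0"
        using b00 c00 by (cases "k = 0"; cases "k = 1") (auto simp: p_def simp del: recP.simps)
      then show ?thesis
        unfolding poly_all_0_iff_0 using recP_independent[of "\<alpha> t k"] b00 c00
        by (metis less_one not_le)
    qed
    then show "toda_system a b c" using E_iff by blast
  qed
qed

section \<open>Moments\<close>

text \<open>An index shift inside a fixed range changes the sum only by boundary terms, which cancel
  here.\<close>

lemma sum_lessThan_shift_cyclic:
  fixes g :: "nat \<Rightarrow> 'a::ab_group_add"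
  assumes "g M = g 0"
  shows "(\<Sum>k<M. g (Suc k)) = (\<Sum>k<M. g k)"
  using sum.lessThan_Suc_shift[of g M] sum.lessThan_Suc[of g M] assms by simp

text \<open>This is \<open>(x_n J) v = x_n (J v)\<close>. The row has finite support, and
  \<open>M\<close> is large enough for all upper boundary terms of the index shifts to vanish; the
  lower ones vanish by \<open>b 0 = c 0 = 0\<close>.\<close>

lemma jrow_pairing:
  assumes b0: "b 0 t = 0" and c0: "c 0 t = 0" and M: "n + 1 < M"
  shows "(\<Sum>k<M. jrow a b c t (Suc n) k * v k) = (\<Sum>k<M. jrow a b c t n k *
     (v (k + 1) + a (k + 1) t * v k + b k t * v (k - 1) + c (k - 1) t * v (k - 2)))"
proof -
  define x where "x = jrow a b c t n"
  have x0: "x k = 0" if "k > n" for k using that by (simp add: x_def jrow_eq_0)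
  have "(\<Sum>k<M. x k * v (k + 1)) = (\<Sum>k<M. (if k = 0 then 0 else x (k - 1)) * v k)"
    using sum_lessThan_shift_cyclic[of "\<lambda>k. (if k = 0 then 0 else x (k - 1)) * v k" M] M
    by (simp add: x0)
  moreover have "(\<Sum>k<M. b (k + 1) t * x (k + 1) * v k) = (\<Sum>k<M. b k t * x k * v (k - 1))"
    using sum_lessThan_shift_cyclic[of "\<lambda>k. b k t * x k * v (k - 1)" M] M by (simp add: x0 b0)
  \<comment> \<open>The second subdiagonal requires a shift by two, done as two single
    shifts.\<close>
  moreover have "(\<Sum>k<M. c (k + 1) t * x (k + 2) * v k) = (\<Sum>k<M. c (k - 1) t * x k * v (k - 2))"
    using sum_lessThan_shift_cyclic[of "\<lambda>k. c (k - 1) t * x k * v (k - 2)" M]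
      sum_lessThan_shift_cyclic[of "\<lambda>k. c k t * x (k + 1) * v (k - 1)" M] M by (simp add: x0 c0)
  ultimately show ?thesis
    unfolding jrow.simps x_def[symmetric] by (simp add: algebra_simps sum.distrib)
qed

text \<open>The hypothesis on \<open>v\<close> says \<open>v (Suc q) = J (v q)\<close>. The lemma
  serves for the formal eigenvector \<open>z^q P_k(z)\<close>, which gives the expansion of
  monomials, and for \<open>J^q e_j\<close>, which identifies rows of matrix powers with operator
  powers.\<close>

lemma jrow_pairing_iterate:
  assumes b0: "b 0 t = 0" and c0: "c 0 t = 0"
    and v: "\<And>q k. v (Suc q) k =
      v q (k + 1) + a (k + 1) t * v q k + b k t * v q (k - 1) + c (k - 1) t * v q (k - 2)"
    and M: "n < M"
  shows "(\<Sum>k<M. jrow a b c t n k * v q k) = v (n + q) 0"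
  using M
proof (induction n arbitrary: q)
  case 0
  then show ?case by (simp add: if_distrib[of "\<lambda>x. x * _"] cong: if_cong)
next
  case (Suc n)
  have "(\<Sum>k<M. jrow a b c t (Suc n) k * v q k) = (\<Sum>k<M. jrow a b c t n k * v (Suc q) k)"
    unfolding v using Suc.prems by (intro jrow_pairing b0 c0) simp
  also have "\<dots> = v (n + Suc q) 0" using Suc by simp
  finally show ?case by simp
qed

text \<open>By the recurrence, the sequence of all \<open>P_k(z)\<close> is a formal eigenvector of
  J with eigenvalue z and first entry 1. Pairing it with the first row of \<open>J^n\<close> gives
  \<open>z^n\<close>.\<close>

lemma monom_eq_sum_jrow_recP:
  assumes b0: "\<And>t. b 0 t = 0" and c0: "\<And>t. c 0 t = 0" and M: "n < M"
  shows "monom 1 n = (\<Sum>k<M. smult (jrow a b c t n k) (recP a b c t k))"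
proof -
  have "poly (monom 1 n) z = poly (\<Sum>k<M. smult (jrow a b c t n k) (recP a b c t k)) z" for z
    using jrow_pairing_iterate[where v = "\<lambda>q k. z ^ q * poly (recP a b c t k) z" and b = b and a = a and c = c
        and t = t and n = n and M = M and q = 0]
      recP_Suc[where a = a and b = b and c = c and t = t, OF b0 c0] M
    by (simp add: poly_monom poly_sum b0 c0 algebra_simps)
  then show ?thesis unfolding poly_eq_poly_eq_iff[symmetric] by (rule ext)
qed

text \<open>The values of the functionals of \<open>U\<close> at \<open>z\<^sup>n\<close>, that is, the first row of \<open>C\<^sub>0\<^sup>-\<^sup>1 (J\<^sup>n)\<^sub>1\<^sub>1 C\<^sub>0\<close>.\<close>

definition moment :: "coeffs \<Rightarrow> coeffs \<Rightarrow> coeffs \<Rightarrow> real \<Rightarrow> nat \<Rightarrow> complex^2" where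
  "moment a b c t n = vector [jrow a b c t n 0 - a 1 t * jrow a b c t n 1, jrow a b c t n 1]"

text \<open>Orthogonality leaves only the components along \<open>P_0\<close> and
  \<open>P_1\<close>, so \<open>W Q = X ** W B_0\<close> with a matrix \<open>X\<close> that does
  not depend on \<open>W\<close>. The normalization cancels \<open>W B_0\<close> and leaves
  \<open>X ** C_0\<close>.\<close>

lemma functional_eq_moments:
  assumes b0: "\<And>t. b 0 t = 0" and c0: "\<And>t. c 0 t = 0"
    and W: "vector_of_functionals a b c t W" and inv: "invertible (W (Bvec a b c t 0))"
  shows "right_mult_functional W (matrix_inv (W (Bvec a b c t 0)) ** Cmat a b c 0 t) Q $ i $ j =
    (\<Sum>n\<le>degree (Q $ i). coeff (Q $ i) n * moment a b c t n $ j)"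
proof -
  let ?x = "jrow a b c t" and ?P = "recP a b c t"
  obtain u1 u2 where lin: "Vector_Spaces.linear smult (*) u1" "Vector_Spaces.linear smult (*) u2"
    and WQ: "\<forall>Q. W Q = vector [vector [u1 (Q $ 1), u2 (Q $ 1)], vector [u1 (Q $ 2), u2 (Q $ 2)]]"
    and orth: "\<forall>m\<ge>1. \<forall>u\<in>{u1, u2}. \<forall>j<m.
       u (monom 1 j * ?P (2*m)) = 0 \<and> u (monom 1 j * ?P (2*m + 1)) = 0"
    using W unfolding vector_of_functionals_def by (elim exE conjE) (rule that)
  note WQ = WQ[rule_format]
  have val: "u p = (\<Sum>n\<le>degree p. coeff p n * ?x n 0) * u (?P 0)
      + (\<Sum>n\<le>degree p. coeff p n * ?x n 1) * u (?P 1)"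
    if u: "Vector_Spaces.linear smult (*) u" "u \<in> {u1, u2}" for u p
  proof -
    interpret u: Vector_Spaces.linear smult "(*)" u by (rule u)
    \<comment> \<open>With \<open>m = k div 2\<close>, \<open>k\<close> is \<open>2*m\<close> or
      \<open>2*m + 1\<close>; orthogonality to the constant (\<open>j = 0\<close>) suffices.\<close>
    have P0: "u (?P k) = 0" if "k \<ge> 2" for k
    proof -
      have "k = 2 * (k div 2) \<or> k = 2 * (k div 2) + 1" by linarith
      moreover have "k div 2 \<ge> 1" using that by linarith
      ultimately show ?thesis
        using orth[rule_format, of "k div 2" u 0] u(2) by (auto simp del: recP.simps)
    qed
    have "u (monom 1 n) = ?x n 0 * u (?P 0) + ?x n 1 * u (?P 1)" for n
    proof -
      have "u (monom 1 n) = (\<Sum>k<n + 2. ?x n k * u (?P k))"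
        using monom_eq_sum_jrow_recP[of b c n "n + 2" a t] b0 c0 by (simp add: u.sum u.scale del: sum.lessThan_Suc)
      also have "\<dots> = (\<Sum>k\<in>{0, 1}. ?x n k * u (?P k))"
        by (rule sum.mono_neutral_right) (auto simp: P0)
      finally show ?thesis by simp
    qed
    moreover have "u p = (\<Sum>n\<le>degree p. coeff p n * u (monom 1 n))"
      by (subst poly_as_sum_of_monoms[symmetric]) (simp add: u.sum u.scale[symmetric] smult_monom)
    ultimately show ?thesis
      by (simp add: sum_distrib_right sum.distrib distrib_left mult.assoc del: recP.simps)
  qed
  define X :: "complex^2^2" where "X = (\<chi> i. vector [\<Sum>n\<le>degree (Q $ i). coeff (Q $ i) n * ?x n 0,
     \<Sum>n\<le>degree (Q $ i). coeff (Q $ i) n * ?x n 1])"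
  have P: "Bvec a b c t 0 $ 1 = ?P 0" "Bvec a b c t 0 $ 2 = ?P 1" by (simp_all add: Bvec_def del: recP.simps)
  have "W Q = X ** W (Bvec a b c t 0)"
    unfolding vec_eq_iff forall_2 matrix_matrix_mult_def X_def WQ P
    using val[OF lin(1), of "Q $ 1"] val[OF lin(1), of "Q $ 2"]
      val[OF lin(2), of "Q $ 1"] val[OF lin(2), of "Q $ 2"]
    by (simp add: sum_2 del: recP.simps)
  then have "W Q ** (matrix_inv (W (Bvec a b c t 0)) ** Cmat a b c 0 t)
      = X ** (W (Bvec a b c t 0) ** matrix_inv (W (Bvec a b c t 0))) ** Cmat a b c 0 t"
    by (simp add: matrix_mul_assoc)
  also have "\<dots> = X ** Cmat a b c 0 t" by (simp add: matrix_inv_right inv)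
  finally have U: "W Q ** (matrix_inv (W (Bvec a b c t 0)) ** Cmat a b c 0 t) = X ** Cmat a b c 0 t" .
  show ?thesis
    unfolding right_mult_functional_def U using exhaust_2[of j]
    by (auto simp: matrix_matrix_mult_def sum_2 X_def Cmat_def moment_def
        right_diff_distrib sum_subtractf sum_distrib_left sum_negf mult_ac simp del: jrow.simps)
qed

text \<open>This is the first row of assertion (f), entry by entry: the matrix of
  \<open>z^n P_0\<close> has the moments \<open>n\<close> and \<open>n + 1\<close> as its
  rows.\<close>

definition moment_flow :: "coeffs \<Rightarrow> coeffs \<Rightarrow> coeffs \<Rightarrow> bool" where
  "moment_flow a b c \<longleftrightarrow> (\<forall>n t j. ((\<lambda>s. moment a b c s n $ j) has_vector_derivative
     moment a b c t (Suc n) $ j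
     - (moment a b c t n $ 1 * moment a b c t 1 $ j + moment a b c t n $ 2 * moment a b c t 2 $ j)) (at t))"

text \<open>The moments 1 and 2 are \<open>(0, 1)\<close> and
  \<open>(b_1 - a_1 a_2, a_1 + a_2)\<close>. Inserting them turns the right-hand sides into
  combinations of the row velocities; the hypothesis \<open>a_1' = b_1\<close> supplies the
  product-rule term.\<close>

lemma moment_flow_iff_row_flow:
  assumes a1: "\<forall>t. (a 1 has_vector_derivative b 1 t) (at t)"
  shows "moment_flow a b c \<longleftrightarrow> row_flow a b c 0 \<and> row_flow a b c 1"
proof -
  let ?x = "jrow a b c"
  have rhs2: "moment a b c t (Suc n) $ 2 - (moment a b c t n $ 1 * moment a b c t 1 $ 2
      + moment a b c t n $ 2 * moment a b c t 2 $ 2) = b 2 t * ?x t n 2 + c 2 t * ?x t n 3" for t n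
    by (simp add: moment_def numeral_2_eq_2 numeral_3_eq_3 algebra_simps)
  have rhs1: "moment a b c t (Suc n) $ 1 - (moment a b c t n $ 1 * moment a b c t 1 $ 1
      + moment a b c t n $ 2 * moment a b c t 2 $ 1) = b 1 t * ?x t n 1 + c 1 t * ?x t n 2
      - (a 1 t * (b 2 t * ?x t n 2 + c 2 t * ?x t n 3) + b 1 t * ?x t n 1)" for t n
    by (simp add: moment_def numeral_2_eq_2 numeral_3_eq_3 algebra_simps)
  have mult: "((\<lambda>s. a 1 s * f s) has_vector_derivative a 1 t * f' + b 1 t * f t) (at t)"
    if "(f has_vector_derivative f') (at t)" for f f' t
    using has_vector_derivative_mult[OF a1[rule_format] that] .
  \<comment> \<open>The passage from \<open>(f, g)\<close> to \<open>(f - a_1 g, g)\<close> is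
    invertible with differentiable coefficients, so derivatives transfer both ways.\<close>
  have iff: "((\<lambda>s. f s - a 1 s * g s) has_vector_derivative F - (a 1 t * G + b 1 t * g t)) (at t)
      \<and> (g has_vector_derivative G) (at t)
    \<longleftrightarrow> (f has_vector_derivative F) (at t) \<and> (g has_vector_derivative G) (at t)" for f g F G t
    using has_vector_derivative_diff[OF _ mult[of g G t], of f F]
      has_vector_derivative_add[OF _ mult[of g G t], of "\<lambda>s. f s - a 1 s * g s" "F - (a 1 t * G + b 1 t * g t)"]
    by auto
  show ?thesis
    unfolding moment_flow_def forall_2 rhs1 rhs2 row_flow_def
    unfolding moment_def vector_2 iff[where f = "\<lambda>s. ?x s n 0" and g = "\<lambda>s. ?x s n 1" for n]
    by (auto simp: numeral_2_eq_2 numeral_3_eq_3 simp del: jrow.simps)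
qed

lemma functional_power_eq_moment:
  assumes U: "\<And>t Q i j. U t Q $ i $ j = (\<Sum>n\<le>degree (Q $ i). coeff (Q $ i) n * moment a b c t n $ j)"
  shows "U t (monom 1 n *s Pvec 0) = vector [moment a b c t n, moment a b c t (Suc n)]"
  unfolding vec_eq_iff forall_2 U
  by (simp add: Pvec_def mult_monom degree_monom_eq if_distrib[of "\<lambda>x. x * _"] cong: if_cong)

lemma functional_shift:
  assumes U: "\<And>t Q i j. U t Q $ i $ j = (\<Sum>n\<le>degree (Q $ i). coeff (Q $ i) n * moment a b c t n $ j)"
  shows "U t (monom 1 1 *s Q) $ i $ j =
    (\<Sum>n\<le>degree (Q $ i). coeff (Q $ i) n * moment a b c t (Suc n) $ j)"
proof (cases "Q $ i = 0")
  case False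
  have "monom 1 1 * Q $ i = pCons 0 (Q $ i)" by (simp add: monom_Suc)
  with False show ?thesis unfolding U
    by (simp add: degree_pCons_eq sum.atMost_Suc_shift del: sum.atMost_Suc)
qed (simp add: U)

text \<open>The second row of (f) at \<open>n\<close> is its first row at \<open>n + 1\<close>. For
  (h), every value is a finite combination of moments with coefficients constant in time, and
  multiplication by z raises each moment index by one; conversely, (f) is (h) at
  \<open>z^n P_0\<close>.\<close>

lemma functional_flow_iff:
  assumes U: "\<And>t Q i j. U t Q $ i $ j = (\<Sum>n\<le>degree (Q $ i). coeff (Q $ i) n * moment a b c t n $ j)"
  shows "(\<forall>Q t. ((\<lambda>s. U s Q) has_vector_derivative
         U t (monom 1 1 *s Q) - U t Q ** U t (monom 1 1 *s Pvec 0)) (at t)) \<longleftrightarrow> moment_flow a b c" (is ?H)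
    and "(\<forall>n t. ((\<lambda>s. U s (monom 1 n *s Pvec 0)) has_vector_derivative
         U t (monom 1 (n + 1) *s Pvec 0) - U t (monom 1 n *s Pvec 0) ** U t (monom 1 1 *s Pvec 0)) (at t))
       \<longleftrightarrow> moment_flow a b c" (is ?F)
proof -
  have F: ?F
  proof
    show "moment_flow a b c" if "\<forall>n t. ((\<lambda>s. U s (monom 1 n *s Pvec 0)) has_vector_derivative
         U t (monom 1 (n + 1) *s Pvec 0) - U t (monom 1 n *s Pvec 0) ** U t (monom 1 1 *s Pvec 0)) (at t)"
      using that unfolding moment_flow_def has_vector_derivative_matrix2_iff functional_power_eq_moment[OF U]
      by (simp add: forall_2 matrix_matrix_mult_def sum_2 numeral_2_eq_2)
  next
    assume "moment_flow a b c"
    note m = this[unfolded moment_flow_def, rule_format]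
    show "\<forall>n t. ((\<lambda>s. U s (monom 1 n *s Pvec 0)) has_vector_derivative
         U t (monom 1 (n + 1) *s Pvec 0) - U t (monom 1 n *s Pvec 0) ** U t (monom 1 1 *s Pvec 0)) (at t)"
      unfolding has_vector_derivative_matrix2_iff functional_power_eq_moment[OF U]
      using m[of n for n] m[of "Suc n" for n]
      by (simp add: forall_2 matrix_matrix_mult_def sum_2 numeral_2_eq_2)
  qed
  show ?H
  proof
    assume H: "\<forall>Q t. ((\<lambda>s. U s Q) has_vector_derivative
         U t (monom 1 1 *s Q) - U t Q ** U t (monom 1 1 *s Pvec 0)) (at t)"
    have "monom 1 1 *s (monom 1 n *s Pvec 0) = monom 1 (n + 1) *s Pvec 0" for n
      by (simp add: vector_smult_assoc mult_monom)
    then show "moment_flow a b c" using H F by metis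
  next
    assume "moment_flow a b c"
    note m = this[unfolded moment_flow_def, rule_format]
    show "\<forall>Q t. ((\<lambda>s. U s Q) has_vector_derivative
         U t (monom 1 1 *s Q) - U t Q ** U t (monom 1 1 *s Pvec 0)) (at t)"
      unfolding has_vector_derivative_matrix2_iff
    proof (intro allI)
      fix Q t and i j :: 2
      have "((\<lambda>s. U s Q $ i $ j) has_vector_derivative (\<Sum>n\<le>degree (Q $ i). coeff (Q $ i) n *
        (moment a b c t (Suc n) $ j
        - (moment a b c t n $ 1 * moment a b c t 1 $ j + moment a b c t n $ 2 * moment a b c t 2 $ j)))) (at t)"
        unfolding U by (intro has_vector_derivative_sum has_vector_derivative_mult_right m)
      also have "(\<Sum>n\<le>degree (Q $ i). coeff (Q $ i) n *
        (moment a b c t (Suc n) $ j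
        - (moment a b c t n $ 1 * moment a b c t 1 $ j + moment a b c t n $ 2 * moment a b c t 2 $ j)))
        = (U t (monom 1 1 *s Q) - U t Q ** U t (monom 1 1 *s Pvec 0)) $ i $ j"
        unfolding functional_power_eq_moment[OF U] vector_minus_component functional_shift[OF U]
        by (simp add: matrix_matrix_mult_def sum_2 U numeral_2_eq_2
            sum_distrib_right sum_subtractf[symmetric] sum.distrib[symmetric] algebra_simps)
      finally show "((\<lambda>s. U s Q $ i $ j) has_vector_derivative
        (U t (monom 1 1 *s Q) - U t Q ** U t (monom 1 1 *s Pvec 0)) $ i $ j) (at t)" .
    qed
  qed
  show ?F by (rule F)
qed

section \<open>The operator of the banded matrix\<close>

definition coeff_bound :: "coeffs \<Rightarrow> coeffs \<Rightarrow> coeffs \<Rightarrow> real \<Rightarrow> real \<Rightarrow> bool" where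
  "coeff_bound a b c K t \<longleftrightarrow>
     0 \<le> K \<and> (\<forall>n\<ge>1. cmod (a n t) \<le> K \<and> cmod (b n t) \<le> K \<and> cmod (c n t) \<le> K)"

lemma coeff_bound_coord:
  assumes "coeff_bound a b c K t"
  shows "ell2_coord (op_of_imat (Jmat a b c t) x) k =
           a (k + 1) t * ell2_coord x k + ell2_coord x (k + 1)
           + (if k \<ge> 1 then b k t * ell2_coord x (k - 1) else 0)
           + (if k \<ge> 2 then c (k - 1) t * ell2_coord x (k - 2) else 0)"
  using assms by (intro ell2_coord_op_Jmat[of a t K b c]) (auto simp: coeff_bound_def)

lemma ell2_eqI: "(\<And>k. ell2_coord x k = ell2_coord y k) \<Longrightarrow> x = y"
  by (metis ell2_coord_inject ext)

lemma ell2_coord_diff: "ell2_coord (x - y) k = ell2_coord x k - ell2_coord y k"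
  unfolding minus_ell2_def plus_ell2.rep_eq uminus_ell2.rep_eq by simp

section \<open>Norms of banded operators on square-summable sequences\<close>

lemma norm_ell2_le:
  assumes "\<And>n. L2_set (\<lambda>k. cmod (ell2_coord x k)) {..<n} \<le> B"
  shows "norm x \<le> B"
proof -
  have B: "0 \<le> B" using assms[of 0] by simp
  have "(\<Sum>k. (cmod (ell2_coord x k))\<^sup>2) \<le> B\<^sup>2"
  proof (rule suminf_le_const[OF summable_ell2_coord])
    fix n
    have "(L2_set (\<lambda>k. cmod (ell2_coord x k)) {..<n})\<^sup>2 \<le> B\<^sup>2"
      using assms by (intro power_mono) auto
    then show "(\<Sum>k<n. (cmod (ell2_coord x k))\<^sup>2) \<le> B\<^sup>2"
      by (simp add: L2_set_def sum_nonneg)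
  qed
  then show ?thesis unfolding norm_ell2_def using B by (intro real_le_lsqrt) auto
qed

lemma cmod_ell2_coord_le: "cmod (ell2_coord x k) \<le> norm x"
  using member_le_L2_set[of "{..<Suc k}" k "\<lambda>k. cmod (ell2_coord x k)"]
    L2_set_le_norm_ell2[of x "Suc k"] by simp

lemma norm_ell2_unit: "norm (ell2_unit k) \<le> 1"
proof (rule norm_ell2_le)
  fix n
  have "(\<Sum>l<n. (cmod (ell2_coord (ell2_unit k) l))\<^sup>2) = (\<Sum>l<n. if l = k then 1 else 0)"
    by (intro sum.cong) (auto simp: ell2_coord_ell2_unit)
  then show "L2_set (\<lambda>l. cmod (ell2_coord (ell2_unit k) l)) {..<n} \<le> 1"
    by (simp add: L2_set_def)
qed

lemma sum_lessThan_delay: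
  fixes f :: "nat \<Rightarrow> 'a::comm_monoid_add"
  shows "(\<Sum>k<n. if j \<le> k then f (k - j) else 0) = (\<Sum>k<n - j. f k)"
  by (induction n) (auto simp: Suc_diff_le not_less_eq_eq)

text \<open>Every shift is a contraction, so four diagonals contribute \<open>3 * e + h\<close>. The
  superdiagonal weight \<open>h\<close> is kept apart: it is 1 for J and 0 for a difference of two
  such matrices.\<close>

lemma norm_ell2_banded_le:
  assumes e: "0 \<le> e" and h: "0 \<le> h"
    and band: "\<And>k. cmod (ell2_coord y k) \<le> e * cmod (ell2_coord x k) + h * cmod (ell2_coord x (k + 1))
      + e * (if 1 \<le> k then cmod (ell2_coord x (k - 1)) else 0)
      + e * (if 2 \<le> k then cmod (ell2_coord x (k - 2)) else 0)"
  shows "norm y \<le> (3 * e + h) * norm x"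
proof (rule norm_ell2_le)
  fix n
  define X where "X k = cmod (ell2_coord x k)" for k
  have up: "L2_set (\<lambda>k. X (k + 1)) {..<n} \<le> norm x"
  proof -
    have "L2_set (\<lambda>k. X (k + 1)) {..<n} \<le> L2_set X {..<Suc n}"
      unfolding L2_set_def by (simp add: sum.lessThan_Suc_shift del: sum.lessThan_Suc)
    also have "\<dots> \<le> norm x" unfolding X_def by (rule L2_set_le_norm_ell2)
    finally show ?thesis .
  qed
  have down: "L2_set (\<lambda>k. if j \<le> k then X (k - j) else 0) {..<n} \<le> norm x" for j
  proof -
    have "(\<Sum>k<n. (if j \<le> k then X (k - j) else 0)\<^sup>2) = (\<Sum>k<n - j. (X k)\<^sup>2)"
      by (subst sum_lessThan_delay[symmetric]) (auto intro: sum.cong)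
    then have "L2_set (\<lambda>k. if j \<le> k then X (k - j) else 0) {..<n} = L2_set X {..<n - j}"
      by (simp add: L2_set_def)
    also have "\<dots> \<le> norm x" unfolding X_def by (rule L2_set_le_norm_ell2)
    finally show ?thesis .
  qed
  have "L2_set (\<lambda>k. cmod (ell2_coord y k)) {..<n} \<le> L2_set (\<lambda>k. e * X k + h * X (k + 1)
      + e * (if 1 \<le> k then X (k - 1) else 0) + e * (if 2 \<le> k then X (k - 2) else 0)) {..<n}"
    unfolding X_def by (rule L2_set_mono[OF band]) simp
  also have "\<dots> \<le> L2_set (\<lambda>k. e * X k + h * X (k + 1) + e * (if 1 \<le> k then X (k - 1) else 0)) {..<n}
      + L2_set (\<lambda>k. e * (if 2 \<le> k then X (k - 2) else 0)) {..<n}"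
    by (rule L2_set_triangle_ineq)
  also have "\<dots> \<le> L2_set (\<lambda>k. e * X k + h * X (k + 1)) {..<n}
      + L2_set (\<lambda>k. e * (if 1 \<le> k then X (k - 1) else 0)) {..<n}
      + L2_set (\<lambda>k. e * (if 2 \<le> k then X (k - 2) else 0)) {..<n}"
    by (intro add_right_mono L2_set_triangle_ineq)
  also have "\<dots> \<le> L2_set (\<lambda>k. e * X k) {..<n} + L2_set (\<lambda>k. h * X (k + 1)) {..<n}
      + L2_set (\<lambda>k. e * (if 1 \<le> k then X (k - 1) else 0)) {..<n}
      + L2_set (\<lambda>k. e * (if 2 \<le> k then X (k - 2) else 0)) {..<n}"
    by (intro add_right_mono L2_set_triangle_ineq)
  also have "\<dots> \<le> e * norm x + h * norm x + e * norm x + e * norm x"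
    unfolding L2_set_right_distrib[OF e, symmetric] L2_set_right_distrib[OF h, symmetric]
    by (intro add_mono mult_left_mono up down e h) (simp add: X_def L2_set_le_norm_ell2)
  finally show "L2_set (\<lambda>k. cmod (ell2_coord y k)) {..<n} \<le> (3 * e + h) * norm x"
    by (simp add: algebra_simps)
qed

lemma norm_op_Jmat_le:
  assumes K: "coeff_bound a b c K t"
  shows "norm (op_of_imat (Jmat a b c t) x) \<le> (3 * K + 1) * norm x"
proof (rule norm_ell2_banded_le)
  fix k
  show "cmod (ell2_coord (op_of_imat (Jmat a b c t) x) k) \<le> K * cmod (ell2_coord x k)
      + 1 * cmod (ell2_coord x (k + 1))
      + K * (if 1 \<le> k then cmod (ell2_coord x (k - 1)) else 0)
      + K * (if 2 \<le> k then cmod (ell2_coord x (k - 2)) else 0)"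
    unfolding coeff_bound_coord[OF K]
    by (intro norm_triangle_le add_mono)
      (use K in \<open>auto simp: coeff_bound_def norm_mult intro!: mult_right_mono\<close>)
qed (use K in \<open>auto simp: coeff_bound_def\<close>)

lemma bounded_linear_op_Jmat:
  assumes K: "coeff_bound a b c K t"
  shows "bounded_linear (op_of_imat (Jmat a b c t))"
proof (rule bounded_linear_intro)
  show "norm (op_of_imat (Jmat a b c t) x) \<le> norm x * (3 * K + 1)" for x
    using norm_op_Jmat_le[OF K, of x] by (simp add: mult.commute)
qed (auto intro!: ell2_eqI simp: coeff_bound_coord[OF K] plus_ell2.rep_eq scaleR_ell2.rep_eq algebra_simps)

lemma Jnorm_le: "coeff_bound a b c K t \<Longrightarrow> Jnorm a b c t \<le> 3 * K + 1"
  unfolding Jnorm_def by (rule onorm_bound) (auto simp: norm_op_Jmat_le coeff_bound_def)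

lemma Jnorm_nonneg: "coeff_bound a b c K t \<Longrightarrow> 0 \<le> Jnorm a b c t"
  unfolding Jnorm_def by (rule onorm_pos_le[OF bounded_linear_op_Jmat])

text \<open>The superdiagonal ones cancel in J(s) - J(t), leaving three diagonals with entries of
  size at most \<open>e\<close>.\<close>

lemma Jnorm_Lipschitz:
  assumes s: "coeff_bound a b c K s" and t: "coeff_bound a b c K t" and e: "0 \<le> e"
    and close: "\<And>n. n \<ge> 1 \<Longrightarrow> cmod (a n s - a n t) \<le> e \<and> cmod (b n s - b n t) \<le> e \<and> cmod (c n s - c n t) \<le> e"
  shows "Jnorm a b c s \<le> Jnorm a b c t + 3 * e"
  unfolding Jnorm_def[of a b c s]
proof (rule onorm_bound)
  fix x
  let ?S = "op_of_imat (Jmat a b c s) x" and ?T = "op_of_imat (Jmat a b c t) x"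
  have "norm (?S - ?T) \<le> (3 * e + 0) * norm x"
  proof (rule norm_ell2_banded_le)
    fix k
    have "ell2_coord (?S - ?T) k = (a (k + 1) s - a (k + 1) t) * ell2_coord x k
        + (if k \<ge> 1 then (b k s - b k t) * ell2_coord x (k - 1) else 0)
        + (if k \<ge> 2 then (c (k - 1) s - c (k - 1) t) * ell2_coord x (k - 2) else 0)"
      unfolding ell2_coord_diff coeff_bound_coord[OF s] coeff_bound_coord[OF t]
      by (simp add: algebra_simps)
    also have "cmod \<dots> \<le> e * cmod (ell2_coord x k)
        + e * (if 1 \<le> k then cmod (ell2_coord x (k - 1)) else 0)
        + e * (if 2 \<le> k then cmod (ell2_coord x (k - 2)) else 0)"
      by (intro norm_triangle_le add_mono) (use close in \<open>auto simp: norm_mult intro!: mult_right_mono\<close>)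
    finally show "cmod (ell2_coord (?S - ?T) k) \<le> e * cmod (ell2_coord x k) + 0 * cmod (ell2_coord x (k + 1))
        + e * (if 1 \<le> k then cmod (ell2_coord x (k - 1)) else 0)
        + e * (if 2 \<le> k then cmod (ell2_coord x (k - 2)) else 0)"
      by simp
  qed (use e in auto)
  moreover have "norm ?S \<le> norm ?T + norm (?S - ?T)"
    by (metis add.commute norm_triangle_sub)
  moreover have "norm ?T \<le> Jnorm a b c t * norm x"
    unfolding Jnorm_def by (rule onorm[OF bounded_linear_op_Jmat[OF t]])
  ultimately show "norm ?S \<le> (Jnorm a b c t + 3 * e) * norm x"
    by (simp add: algebra_simps)
qed (use e Jnorm_nonneg[OF t] in simp)

text \<open>This is the entry of \<open>J^n\<close> in row \<open>k + 1\<close> and column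
  \<open>j + 1\<close>, expressed through the operator so that the operator norm bounds it.\<close>

definition Jpow_coord :: "coeffs \<Rightarrow> coeffs \<Rightarrow> coeffs \<Rightarrow> real \<Rightarrow> nat \<Rightarrow> nat \<Rightarrow> nat \<Rightarrow> complex" where
  "Jpow_coord a b c t j n k = ell2_coord ((op_of_imat (Jmat a b c t) ^^ n) (ell2_unit j)) k"

lemma norm_Jpow_le:
  assumes K: "coeff_bound a b c K t"
  shows "norm ((op_of_imat (Jmat a b c t) ^^ n) (ell2_unit j)) \<le> Jnorm a b c t ^ n"
proof (induction n)
  case 0
  then show ?case by (simp add: norm_ell2_unit)
next
  case (Suc n)
  have "norm ((op_of_imat (Jmat a b c t) ^^ Suc n) (ell2_unit j))
      \<le> Jnorm a b c t * norm ((op_of_imat (Jmat a b c t) ^^ n) (ell2_unit j))"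
    unfolding Jnorm_def using onorm[OF bounded_linear_op_Jmat[OF K]] by simp
  also have "\<dots> \<le> Jnorm a b c t * Jnorm a b c t ^ n"
    by (intro mult_left_mono Suc Jnorm_nonneg[OF K])
  finally show ?case by simp
qed

lemma Jpow_coord_0: "Jpow_coord a b c t j 0 k = (if k = j then 1 else 0)"
  by (simp add: Jpow_coord_def ell2_coord_ell2_unit)

lemma Jpow_coord_Suc:
  assumes K: "coeff_bound a b c K t"
  shows "Jpow_coord a b c t j (Suc n) k =
    a (k + 1) t * Jpow_coord a b c t j n k + Jpow_coord a b c t j n (k + 1)
    + (if k \<ge> 1 then b k t * Jpow_coord a b c t j n (k - 1) else 0)
    + (if k \<ge> 2 then c (k - 1) t * Jpow_coord a b c t j n (k - 2) else 0)"
  by (simp add: Jpow_coord_def coeff_bound_coord[OF K])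

text \<open>Operator powers build columns, \<open>jrow\<close> builds a row; the pairing with
  \<open>J^q e_j\<close> reconciles them. The second row of \<open>J^n\<close> is then read off from
  the first row of \<open>J^{n+1} = J J^n\<close>.\<close>

lemma Jpow_coord_eq_jrow:
  assumes K: "coeff_bound a b c K t" and b0: "b 0 t = 0" and c0: "c 0 t = 0"
  shows "Jpow_coord a b c t j n 0 = jrow a b c t n j"
    and "Jpow_coord a b c t j n 1 = jrow a b c t (Suc n) j - a 1 t * jrow a b c t n j"
proof -
  have "Jpow_coord a b c t j (Suc q) k = Jpow_coord a b c t j q (k + 1) + a (k + 1) t * Jpow_coord a b c t j q k
      + b k t * Jpow_coord a b c t j q (k - 1) + c (k - 1) t * Jpow_coord a b c t j q (k - 2)" for q k
  proof -
    consider "k = 0" | "k = 1" | "k \<ge> 2" by linarith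
    then show ?thesis by cases (simp_all add: Jpow_coord_Suc[OF K] b0 c0)
  qed
  then have row: "Jpow_coord a b c t j n 0 = jrow a b c t n j" for n
    using jrow_pairing_iterate[of b t c "Jpow_coord a b c t j" a n "Suc (n + j)" 0, OF b0 c0]
    by (simp add: Jpow_coord_0 if_distrib[of "\<lambda>x. _ * x"] cong: if_cong del: sum.lessThan_Suc)
  then show "Jpow_coord a b c t j n 0 = jrow a b c t n j" .
  show "Jpow_coord a b c t j n 1 = jrow a b c t (Suc n) j - a 1 t * jrow a b c t n j"
    using Jpow_coord_Suc[OF K, of j n 0] unfolding row by (simp del: jrow.simps)
qed

section \<open>The resolvent\<close>

text \<open>Since \<open>op_of_imat\<close> goes through \<open>Abs_ell2\<close>, linearity in the
  matrix is not automatic: the rows are summed explicitly and the result is checked to be square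
  summable.\<close>

lemma ell2_coord_resolvent_op:
  assumes K: "coeff_bound a b c K t"
  shows "ell2_coord (op_of_imat (\<lambda>i j. imat_scalar z i j - Jmat a b c t i j) x) k =
    z * ell2_coord x k - ell2_coord (op_of_imat (Jmat a b c t) x) k"
proof -
  define X where "X = ell2_coord x"
  define Y where "Y = ell2_coord (op_of_imat (Jmat a b c t) x)"
  have row: "(\<Sum>l. (imat_scalar z (Suc k) (Suc l) - Jmat a b c t (Suc k) (Suc l)) * X l) = z * X k - Y k"
    (is "suminf ?f = _") for k
  proof -
    have "suminf ?f = sum ?f {k - 2..k + 1}"
      by (rule suminf_finite) (auto simp: Jmat_def imat_scalar_def)
    also have "\<dots> = z * X k - Y k"
    proof -
      consider "k = 0" | "k = 1" | m where "k = m + 2"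
        by (metis One_nat_def Suc_eq_plus1 add_2_eq_Suc' not0_implies_Suc)
      then show ?thesis
      proof cases
        case 1
        then show ?thesis
          by (simp add: Y_def coeff_bound_coord[OF K] X_def Jmat_def imat_scalar_def algebra_simps)
      next
        case 2
        then have "{k - 2..k + 1} = {0, 1, 2}" by auto
        with 2 show ?thesis
          by (simp add: Y_def coeff_bound_coord[OF K] X_def Jmat_def imat_scalar_def numeral_2_eq_2 algebra_simps)
      next
        case 3
        then have "{k - 2..k + 1} = {m, m + 1, m + 2, m + 3}" by auto
        with 3 show ?thesis
          by (simp add: Y_def coeff_bound_coord[OF K] X_def Jmat_def imat_scalar_def numeral_2_eq_2
              numeral_3_eq_3 algebra_simps)
      qed
    qed
    finally show ?thesis .
  qed
  have "summable (\<lambda>k. (cmod (z * X k + - Y k))\<^sup>2)"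
    by (intro summable_cmod_add_power2 summable_cmod_mult_power2[where K = "cmod z"])
      (simp_all add: X_def Y_def summable_ell2_coord)
  then show ?thesis
    unfolding op_of_imat_def[of "\<lambda>i j. imat_scalar z i j - Jmat a b c t i j"] X_def[symmetric] row
    by (simp add: Abs_ell2_inverse X_def Y_def)
qed

text \<open>If \<open>J u = z u\<close>, then the norm of u times |z| is at most its product with
  the operator norm, so \<open>u = 0\<close>. Injectivity fixes the value of \<open>inv\<close>
  wherever a preimage is exhibited.\<close>

lemma inj_resolvent_op:
  assumes K: "coeff_bound a b c K t" and z: "Jnorm a b c t < cmod z"
  shows "inj (op_of_imat (\<lambda>i j. imat_scalar z i j - Jmat a b c t i j))"
proof (rule injI)
  fix x y
  assume eq: "op_of_imat (\<lambda>i j. imat_scalar z i j - Jmat a b c t i j) x =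
    op_of_imat (\<lambda>i j. imat_scalar z i j - Jmat a b c t i j) y"
  let ?T = "op_of_imat (Jmat a b c t)"
  have "ell2_coord (?T (x - y)) k = z * ell2_coord (x - y) k" for k
  proof -
    have "z * ell2_coord x k - ell2_coord (?T x) k = z * ell2_coord y k - ell2_coord (?T y) k"
      using arg_cong[OF eq, of "\<lambda>x. ell2_coord x k"] unfolding ell2_coord_resolvent_op[OF K] .
    moreover have "ell2_coord (?T (x - y)) k = ell2_coord (?T x) k - ell2_coord (?T y) k"
      unfolding linear_diff[OF bounded_linear.linear[OF bounded_linear_op_Jmat[OF K]]]
      by (simp add: ell2_coord_diff)
    ultimately show ?thesis unfolding ell2_coord_diff by algebra
  qed
  then have "norm (?T (x - y)) = cmod z * norm (x - y)"
    by (simp add: norm_ell2_def norm_mult power_mult_distrib suminf_mult summable_ell2_coord real_sqrt_mult)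
  moreover have "norm (?T (x - y)) \<le> Jnorm a b c t * norm (x - y)"
    unfolding Jnorm_def by (rule onorm[OF bounded_linear_op_Jmat[OF K]])
  ultimately have "(cmod z - Jnorm a b c t) * norm (x - y) \<le> 0"
    by (simp add: algebra_simps)
  with z have "norm (x - y) \<le> 0"
    by (simp add: mult_le_0_iff)
  then show "x = y" by simp
qed

lemma summable_geometric_shift:
  fixes \<rho> r :: real
  assumes "0 \<le> \<rho>" and "\<rho> < r"
  shows "summable (\<lambda>n. C * \<rho> ^ n / r ^ (n + 1))"
proof -
  have "summable (\<lambda>n. C / r * (\<rho> / r) ^ n)"
    using assms by (intro summable_mult summable_geometric) simp
  then show ?thesis by (simp add: power_divide)
qed

text \<open>The Neumann series is summed coordinatewise, so that the completeness of \<open>ell2\<close> is not needed.\<close>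

lemma resolvent_coord_sums:
  assumes K: "coeff_bound a b c K t" and z: "Jnorm a b c t < cmod z"
  shows "(\<lambda>n. Jpow_coord a b c t j n k / z ^ (n + 1)) sums
    ell2_coord (inv (op_of_imat (\<lambda>i j. imat_scalar z i j - Jmat a b c t i j)) (ell2_unit j)) k"
proof -
  let ?V = "Jpow_coord a b c t j"
  define g where "g n = Jnorm a b c t ^ n / cmod z ^ (n + 1)" for n
  have J0: "0 \<le> Jnorm a b c t" by (rule Jnorm_nonneg[OF K])
  have z0: "z \<noteq> 0" using z J0 by auto
  have g: "summable g" unfolding g_def
    using summable_geometric_shift[OF J0 z, of 1] by simp
  have g0: "g n \<ge> 0" for n by (simp add: g_def J0)
  define y where "y k = (\<Sum>n. ?V n k / z ^ (n + 1))" for k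
  have y: "(\<lambda>n. ?V n k / z ^ (n + 1)) sums y k" for k
    unfolding y_def
  proof (rule summable_sums, rule summable_comparison_test'[OF g])
    fix n
    show "norm (?V n k / z ^ (n + 1)) \<le> g n"
      unfolding g_def norm_divide norm_power Jpow_coord_def
      by (intro divide_right_mono order_trans[OF cmod_ell2_coord_le norm_Jpow_le[OF K]]) auto
  qed
  \<comment> \<open>This puts \<open>y\<close> into the space: finite sections of the partial sums
    are bounded by the triangle inequality, and the limit is taken with the section fixed.\<close>
  have L2: "L2_set (\<lambda>k. cmod (y k)) {..<N} \<le> suminf g" for N
  proof (rule LIMSEQ_le_const2)
    show "(\<lambda>M. L2_set (\<lambda>k. cmod (\<Sum>n<M. ?V n k / z ^ (n + 1))) {..<N}) \<longlonglongrightarrow> L2_set (\<lambda>k. cmod (y k)) {..<N}"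
      unfolding L2_set_def by (intro tendsto_intros y[unfolded sums_def])
    have "L2_set (\<lambda>k. cmod (\<Sum>n<M. ?V n k / z ^ (n + 1))) {..<N} \<le> sum g {..<M}" for M
    proof (induction M)
      case (Suc M)
      have "L2_set (\<lambda>k. cmod (\<Sum>n<Suc M. ?V n k / z ^ (n + 1))) {..<N}
          \<le> L2_set (\<lambda>k. cmod (\<Sum>n<M. ?V n k / z ^ (n + 1)) + cmod (?V M k) / cmod z ^ (M + 1)) {..<N}"
        by (intro L2_set_mono) (auto simp: norm_divide norm_power norm_mult intro!: order_trans[OF norm_triangle_ineq])
      also have "\<dots> \<le> L2_set (\<lambda>k. cmod (\<Sum>n<M. ?V n k / z ^ (n + 1))) {..<N}
          + L2_set (\<lambda>k. cmod (?V M k) / cmod z ^ (M + 1)) {..<N}"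
        by (rule L2_set_triangle_ineq)
      also have "L2_set (\<lambda>k. cmod (?V M k) / cmod z ^ (M + 1)) {..<N}
          = 1 / cmod z ^ (M + 1) * L2_set (\<lambda>k. cmod (?V M k)) {..<N}"
        by (subst L2_set_right_distrib) auto
      also have "\<dots> \<le> 1 / cmod z ^ (M + 1) * Jnorm a b c t ^ M"
        unfolding Jpow_coord_def
        by (intro mult_left_mono order_trans[OF L2_set_le_norm_ell2 norm_Jpow_le[OF K]]) auto
      finally show ?case using Suc by (simp add: g_def)
    qed (simp add: L2_set_def)
    then show "\<exists>N'. \<forall>M\<ge>N'. L2_set (\<lambda>k. cmod (\<Sum>n<M. ?V n k / z ^ (n + 1))) {..<N} \<le> suminf g"
      using sum_le_suminf[OF g, of "{..<M}" for M] g0 by (meson finite_lessThan order_trans)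
  qed
  have "summable (\<lambda>k. (cmod (y k))\<^sup>2)"
  proof (rule summableI_nonneg_bounded)
    fix N
    have "(L2_set (\<lambda>k. cmod (y k)) {..<N})\<^sup>2 \<le> (suminf g)\<^sup>2"
      using L2 by (intro power_mono) auto
    then show "(\<Sum>k<N. (cmod (y k))\<^sup>2) \<le> (suminf g)\<^sup>2"
      by (simp add: L2_set_def sum_nonneg)
  qed simp
  then have Y: "ell2_coord (Abs_ell2 y) = y" by (simp add: Abs_ell2_inverse)
  \<comment> \<open>The coordinates of \<open>J y\<close> are computed twice: by applying the finite
    band to the series, and by shifting the series index, which gives
    \<open>z y - e_j\<close>.\<close>
  have "op_of_imat (\<lambda>i j. imat_scalar z i j - Jmat a b c t i j) (Abs_ell2 y) = ell2_unit j"
  proof (rule ell2_eqI)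
    fix k
    have "(\<lambda>n. ?V (Suc n) k / z ^ (n + 1)) sums ell2_coord (op_of_imat (Jmat a b c t) (Abs_ell2 y)) k"
    proof -
      have "(\<lambda>n. (a (k + 1) t * (?V n k / z ^ (n + 1)) + ?V n (k + 1) / z ^ (n + 1)
        + (if k \<ge> 1 then b k t else 0) * (?V n (k - 1) / z ^ (n + 1)))
        + (if k \<ge> 2 then c (k - 1) t else 0) * (?V n (k - 2) / z ^ (n + 1))) sums
        (a (k + 1) t * y k + y (k + 1) + (if k \<ge> 1 then b k t else 0) * y (k - 1)
          + (if k \<ge> 2 then c (k - 1) t else 0) * y (k - 2))"
        by (intro sums_add sums_mult y)
      also have "(\<lambda>n. (a (k + 1) t * (?V n k / z ^ (n + 1)) + ?V n (k + 1) / z ^ (n + 1)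
        + (if k \<ge> 1 then b k t else 0) * (?V n (k - 1) / z ^ (n + 1)))
        + (if k \<ge> 2 then c (k - 1) t else 0) * (?V n (k - 2) / z ^ (n + 1))) = (\<lambda>n. ?V (Suc n) k / z ^ (n + 1))"
        unfolding Jpow_coord_Suc[OF K] by (auto simp: add_divide_distrib)
      also have "a (k + 1) t * y k + y (k + 1) + (if k \<ge> 1 then b k t else 0) * y (k - 1)
          + (if k \<ge> 2 then c (k - 1) t else 0) * y (k - 2)
          = ell2_coord (op_of_imat (Jmat a b c t) (Abs_ell2 y)) k"
        unfolding coeff_bound_coord[OF K] Y by simp
      finally show ?thesis .
    qed
    moreover have "(\<lambda>n. ?V (Suc n) k / z ^ (n + 1)) sums (z * y k - ?V 0 k)"
    proof -
      have "(\<lambda>n. ?V (Suc n) k / z ^ (Suc n + 1)) sums (y k - ?V 0 k / z)"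
        using y[of k] by (subst sums_Suc_iff) simp
      from sums_mult[OF this, of z] show ?thesis using z0 by (simp add: algebra_simps)
    qed
    ultimately have "ell2_coord (op_of_imat (Jmat a b c t) (Abs_ell2 y)) k = z * y k - ?V 0 k"
      by (rule sums_unique2)
    then show "ell2_coord (op_of_imat (\<lambda>i j. imat_scalar z i j - Jmat a b c t i j) (Abs_ell2 y)) k
        = ell2_coord (ell2_unit j) k"
      unfolding ell2_coord_resolvent_op[OF K] Y by (simp add: Jpow_coord_0 ell2_coord_ell2_unit)
  qed
  then have "inv (op_of_imat (\<lambda>i j. imat_scalar z i j - Jmat a b c t i j)) (ell2_unit j) = Abs_ell2 y"
    by (rule inv_f_eq[OF inj_resolvent_op[OF K z]])
  then show ?thesis using y Y by simp
qed

lemma matrix_inv_Cmat_0: "matrix_inv (Cmat a b c 0 t) = vector [vector [1, 0], vector [a 1 t, 1]]"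
proof -
  let ?B = "vector [vector [1, 0], vector [a 1 t, 1]] :: complex^2^2"
  have *: "Cmat a b c 0 t ** ?B = mat 1" "?B ** Cmat a b c 0 t = mat 1"
    unfolding vec_eq_iff forall_2 by (simp_all add: Cmat_def matrix_matrix_mult_def sum_2 mat_def)
  then have "invertible (Cmat a b c 0 t)" by (auto simp: invertible_def)
  then have "matrix_inv (Cmat a b c 0 t) = matrix_inv (Cmat a b c 0 t) ** (Cmat a b c 0 t ** ?B)"
    by (simp only: * matrix_mul_rid)
  also have "\<dots> = ?B"
    using \<open>invertible _\<close> by (simp add: matrix_mul_assoc matrix_inv_left)
  finally show ?thesis .
qed

text \<open>Conjugation by \<open>C_0\<close> replaces the second resolvent row by
  \<open>a_1\<close> times the first plus the second. Coefficientwise this is the first row of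
  \<open>J^{n+1}\<close>, whence the shifted moments.\<close>

lemma genfun_sums:
  assumes K: "coeff_bound a b c K t" and z: "Jnorm a b c t < cmod z"
    and b0: "b 0 t = 0" and c0: "c 0 t = 0"
  shows "(\<lambda>n. moment a b c t n $ j / z ^ (n + 1)) sums genfun a b c t z $ 1 $ j"
    and "(\<lambda>n. moment a b c t (Suc n) $ j / z ^ (n + 1)) sums genfun a b c t z $ 2 $ j"
proof -
  let ?x = "jrow a b c t"
  define R where "R = resolvent11 a b c t z"
  have R1: "(\<lambda>n. ?x n 0 / z ^ (n + 1)) sums R $ 1 $ 1" "(\<lambda>n. ?x n 1 / z ^ (n + 1)) sums R $ 1 $ 2"
    using resolvent_coord_sums[OF K z, of 0 0] resolvent_coord_sums[OF K z, of 1 0]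
    by (simp_all add: R_def resolvent11_def block_def imat_of_op_def Jpow_coord_eq_jrow[OF K b0 c0] del: jrow.simps)
  have R2: "(\<lambda>n. (?x (Suc n) 0 - a 1 t * ?x n 0) / z ^ (n + 1)) sums R $ 2 $ 1"
    "(\<lambda>n. (?x (Suc n) 1 - a 1 t * ?x n 1) / z ^ (n + 1)) sums R $ 2 $ 2"
    using resolvent_coord_sums[OF K z, of 0 1] resolvent_coord_sums[OF K z, of 1 1]
    unfolding Jpow_coord_eq_jrow(2)[OF K b0 c0]
    by (simp_all add: R_def resolvent11_def block_def imat_of_op_def del: jrow.simps)
  have G: "genfun a b c t z $ 1 $ 1 = R $ 1 $ 1 - a 1 t * R $ 1 $ 2"
    "genfun a b c t z $ 1 $ 2 = R $ 1 $ 2"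
    "genfun a b c t z $ 2 $ 1 = a 1 t * R $ 1 $ 1 + R $ 2 $ 1 - a 1 t * (a 1 t * R $ 1 $ 2 + R $ 2 $ 2)"
    "genfun a b c t z $ 2 $ 2 = a 1 t * R $ 1 $ 2 + R $ 2 $ 2"
    unfolding genfun_def matrix_inv_Cmat_0
    by (simp_all add: R_def[symmetric] Cmat_def matrix_matrix_mult_def sum_2 algebra_simps)
  have row2: "(\<lambda>n. ?x (Suc n) 0 / z ^ (n + 1)) sums (a 1 t * R $ 1 $ 1 + R $ 2 $ 1)"
    "(\<lambda>n. ?x (Suc n) 1 / z ^ (n + 1)) sums (a 1 t * R $ 1 $ 2 + R $ 2 $ 2)"
    using sums_add[OF sums_mult[OF R1(1), of "a 1 t"] R2(1)] sums_add[OF sums_mult[OF R1(2), of "a 1 t"] R2(2)]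
    by (simp_all add: add_divide_distrib[symmetric] del: jrow.simps)
  have "\<forall>j. (\<lambda>n. moment a b c t n $ j / z ^ (n + 1)) sums genfun a b c t z $ 1 $ j"
    using sums_diff[OF R1(1) sums_mult[OF R1(2), of "a 1 t"]] R1(2)
    by (simp add: forall_2 G moment_def diff_divide_distrib del: jrow.simps)
  then show "(\<lambda>n. moment a b c t n $ j / z ^ (n + 1)) sums genfun a b c t z $ 1 $ j" by blast
  have "\<forall>j. (\<lambda>n. moment a b c t (Suc n) $ j / z ^ (n + 1)) sums genfun a b c t z $ 2 $ j"
    using sums_diff[OF row2(1) sums_mult[OF row2(2), of "a 1 t"]] row2(2)
    by (simp add: forall_2 G moment_def diff_divide_distrib del: jrow.simps)
  then show "(\<lambda>n. moment a b c t (Suc n) $ j / z ^ (n + 1)) sums genfun a b c t z $ 2 $ j" by blast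
qed

section \<open>The generating function\<close>

text \<open>The limit at 0 gives the constant coefficient; dividing by \<open>w\<close> and
  repeating gives the others. The disc is punctured because \<open>w\<close> will be
  \<open>1 / z\<close>.\<close>

lemma powser_sums_zero_imp_coeff_zero:
  fixes d :: "nat \<Rightarrow> complex"
  assumes "0 < s" and "\<And>w. w \<noteq> 0 \<Longrightarrow> cmod w < s \<Longrightarrow> (\<lambda>n. d n * w ^ n) sums 0"
  shows "d n = 0"
  using assms(2)
proof (induction n arbitrary: d)
  case 0
  have "((\<lambda>_. 0) \<longlongrightarrow> d 0) (at (0::complex))"
    using powser_limit_0_strong[OF assms(1), of d "\<lambda>_. 0"] 0 by blast
  then show ?case by (simp add: tendsto_const_iff)
next
  case (Suc n)
  have "((\<lambda>_. 0) \<longlongrightarrow> d 0) (at (0::complex))"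
    using powser_limit_0_strong[OF assms(1), of d "\<lambda>_. 0"] Suc.prems by blast
  then have d0: "d 0 = 0" by (simp add: tendsto_const_iff)
  show ?case
  proof (rule Suc.IH[of "\<lambda>n. d (Suc n)"])
    fix w :: complex
    assume w: "w \<noteq> 0" "cmod w < s"
    have "(\<lambda>n. d (Suc n) * w ^ Suc n) sums 0"
      using Suc.prems[OF w] d0 by (subst sums_Suc_iff) simp
    from sums_mult[OF this, of "1 / w"] show "(\<lambda>n. d (Suc n) * w ^ n) sums 0"
      using w by (simp add: algebra_simps)
  qed
qed

text \<open>Termwise differentiation: the geometric majorant makes the differentiated series
  converge uniformly, and then convergence at the single point \<open>t0\<close> yields convergence
  on all of \<open>S\<close>.\<close>

lemma inverse_power_series_has_vector_derivative:
  fixes p q :: "nat \<Rightarrow> real \<Rightarrow> complex" and z :: complex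
  assumes S: "convex S" "t0 \<in> S"
    and deriv: "\<And>n s. s \<in> S \<Longrightarrow> (p n has_vector_derivative q n s) (at s within S)"
    and bound: "\<And>n s. s \<in> S \<Longrightarrow> cmod (q n s) \<le> C * \<rho> ^ n"
    and \<rho>: "0 \<le> \<rho>" "\<rho> < cmod z"
    and sums: "(\<lambda>n. p n t0 / z ^ (n + 1)) sums l"
  shows "\<exists>P. (\<forall>s\<in>S. (\<lambda>n. p n s / z ^ (n + 1)) sums P s) \<and>
    (\<forall>s\<in>S. (P has_vector_derivative (\<Sum>n. q n s / z ^ (n + 1))) (at s within S))"
proof -
  have lim: "uniform_limit S (\<lambda>N s. \<Sum>n<N. q n s / z ^ (n + 1)) (\<lambda>s. \<Sum>n. q n s / z ^ (n + 1)) sequentially"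
  proof (rule Weierstrass_m_test)
    show "norm (q n s / z ^ (n + 1)) \<le> C * \<rho> ^ n / cmod z ^ (n + 1)" if "s \<in> S" for n s
      unfolding norm_divide norm_power using bound[OF that] by (intro divide_right_mono) auto
  qed (rule summable_geometric_shift[OF \<rho>])
  have "\<exists>P. \<forall>s\<in>S. (\<lambda>n. p n s / z ^ (n + 1)) sums (P s) \<and>
      (P has_derivative (\<lambda>h. h *\<^sub>R (\<Sum>n. q n s / z ^ (n + 1)))) (at s within S)"
  proof (rule has_derivative_series[where f = "\<lambda>n s. p n s / z ^ (n + 1)"
        and f' = "\<lambda>n s h. h *\<^sub>R (q n s / z ^ (n + 1))", OF S(1) _ _ S(2) sums])
    show "((\<lambda>s. p n s / z ^ (n + 1)) has_derivative (\<lambda>h. h *\<^sub>R (q n s / z ^ (n + 1)))) (at s within S)"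
      if "s \<in> S" for n s
      using has_vector_derivative_divide[OF deriv[OF that]] by (simp add: has_vector_derivative_def)
    fix e :: real
    assume "0 < e"
    then have "\<forall>\<^sub>F N in sequentially. \<forall>s\<in>S.
        dist (\<Sum>n<N. q n s / z ^ (n + 1)) (\<Sum>n. q n s / z ^ (n + 1)) < e"
      using lim by (simp add: uniform_limit_iff)
    then show "\<forall>\<^sub>F N in sequentially. \<forall>s\<in>S. \<forall>h. norm ((\<Sum>n<N. h *\<^sub>R (q n s / z ^ (n + 1)))
        - h *\<^sub>R (\<Sum>n. q n s / z ^ (n + 1))) \<le> e * norm h"
    proof eventually_elim
      case (elim N)
      have "norm ((\<Sum>n<N. h *\<^sub>R (q n s / z ^ (n + 1))) - h *\<^sub>R (\<Sum>n. q n s / z ^ (n + 1))) \<le> e * norm h"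
        if "s \<in> S" for s h
      proof -
        have "norm ((\<Sum>n<N. h *\<^sub>R (q n s / z ^ (n + 1))) - h *\<^sub>R (\<Sum>n. q n s / z ^ (n + 1)))
            = \<bar>h\<bar> * norm ((\<Sum>n<N. q n s / z ^ (n + 1)) - (\<Sum>n. q n s / z ^ (n + 1)))"
          unfolding scaleR_sum_right[symmetric] scaleR_diff_right[symmetric] by simp
        also have "\<dots> \<le> \<bar>h\<bar> * e"
          using elim[rule_format, OF that] by (intro mult_left_mono) (auto simp: dist_norm)
        finally show ?thesis by (simp add: mult.commute)
      qed
      then show ?case by blast
    qed
  qed
  then show ?thesis by (auto simp: has_vector_derivative_def)
qed

section \<open>Geometric bounds for the moments and their prescribed velocities\<close>

lemma jrow_bound:
  assumes K: "coeff_bound a b c K t" and b0: "b 0 t = 0" and c0: "c 0 t = 0"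
  shows "cmod (jrow a b c t n k) \<le> Jnorm a b c t ^ n"
  unfolding Jpow_coord_eq_jrow(1)[OF K b0 c0, symmetric] Jpow_coord_def
  by (rule order_trans[OF cmod_ell2_coord_le norm_Jpow_le[OF K]])

lemma moment_bound:
  assumes K: "coeff_bound a b c K t" and b0: "b 0 t = 0" and c0: "c 0 t = 0"
    and \<rho>: "Jnorm a b c t \<le> \<rho>"
  shows "cmod (moment a b c t n $ j) \<le> (1 + K) * \<rho> ^ n"
proof -
  have x: "cmod (jrow a b c t n k) \<le> \<rho> ^ n" for k
    by (rule order_trans[OF jrow_bound[OF K b0 c0] power_mono[OF \<rho> Jnorm_nonneg[OF K]]])
  have K': "0 \<le> K" "cmod (a 1 t) \<le> K" using K by (auto simp: coeff_bound_def)
  have "cmod (jrow a b c t n 0 - a 1 t * jrow a b c t n 1) \<le> \<rho> ^ n + K * \<rho> ^ n"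
    using x K' by (intro order_trans[OF norm_triangle_ineq4] add_mono) (auto simp: norm_mult intro!: mult_mono)
  moreover have "0 \<le> K * \<rho> ^ n"
    using K' x[of 0] norm_ge_zero order_trans by (intro mult_nonneg_nonneg) blast+
  ultimately show ?thesis
    using exhaust_2[of j] x[of 1] by (auto simp: moment_def algebra_simps)
qed

text \<open>The right-hand side of the moment equations gets a name of its own, since it is
  estimated and integrated before the equations are known to hold.\<close>

definition moment_velocity :: "coeffs \<Rightarrow> coeffs \<Rightarrow> coeffs \<Rightarrow> real \<Rightarrow> nat \<Rightarrow> complex^2" where
  "moment_velocity a b c t n = (\<chi> j. moment a b c t (Suc n) $ j
     - (moment a b c t n $ 1 * moment a b c t 1 $ j + moment a b c t n $ 2 * moment a b c t 2 $ j))"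

lemma moment_flow_velocity:
  "moment_flow a b c \<longleftrightarrow> (\<forall>n t j. ((\<lambda>s. moment a b c s n $ j) has_vector_derivative
     moment_velocity a b c t n $ j) (at t))"
  by (simp add: moment_flow_def moment_velocity_def)

lemma moment_velocity_bound:
  assumes K: "coeff_bound a b c K t" and b0: "b 0 t = 0" and c0: "c 0 t = 0"
    and \<rho>: "Jnorm a b c t \<le> \<rho>"
  shows "cmod (moment_velocity a b c t n $ j) \<le> ((1 + K) * \<rho> + 2 * (1 + K)\<^sup>2 * (\<rho> + \<rho>\<^sup>2)) * \<rho> ^ n"
proof -
  note m = moment_bound[OF K b0 c0 \<rho>]
  have \<rho>0: "0 \<le> \<rho>" using \<rho> Jnorm_nonneg[OF K] by simp
  have K0: "0 \<le> K" using K by (simp add: coeff_bound_def)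
  have prod: "cmod (x * y) \<le> A * B" if "cmod x \<le> A" "cmod y \<le> B" for x y A B
    unfolding norm_mult using that by (intro mult_mono) (auto intro: order_trans[OF norm_ge_zero])
  have "cmod (moment_velocity a b c t n $ j) \<le> (1 + K) * \<rho> ^ Suc n
      + ((1 + K) * \<rho> ^ n * ((1 + K) * \<rho> ^ 1) + (1 + K) * \<rho> ^ n * ((1 + K) * \<rho> ^ 2))"
    unfolding moment_velocity_def vec_lambda_beta
    by (intro order_trans[OF norm_triangle_ineq4] add_mono m order_trans[OF norm_triangle_ineq] prod)
  also have "\<dots> \<le> ((1 + K) * \<rho> + 2 * (1 + K)\<^sup>2 * (\<rho> + \<rho>\<^sup>2)) * \<rho> ^ n"
  proof -
    \<comment> \<open>The two products contribute this amount exactly once; the factor 2 in the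
      constant is slack.\<close>
    have "0 \<le> (1 + K)\<^sup>2 * (\<rho> + \<rho>\<^sup>2) * \<rho> ^ n" using K0 \<rho>0 by simp
    then show ?thesis by (simp add: algebra_simps power2_eq_square)
  qed
  finally show ?thesis .
qed

text \<open>Multiplication by z shifts the series and drops its initial coefficient. The rows start
  with the moments 0 and 1, which are the rows of the identity, so subtracting the identity accounts
  for precisely these terms.\<close>

lemma genfun_rhs_sums:
  assumes K: "coeff_bound a b c K t" and z: "Jnorm a b c t < cmod z"
    and b0: "b 0 t = 0" and c0: "c 0 t = 0"
  defines "rhs \<equiv> genfun a b c t z ** (mat z - vector [moment a b c t 1, moment a b c t 2]) - mat 1"
  shows "(\<lambda>n. moment_velocity a b c t n $ j / z ^ (n + 1)) sums rhs $ 1 $ j"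
    and "(\<lambda>n. moment_velocity a b c t (Suc n) $ j / z ^ (n + 1)) sums rhs $ 2 $ j"
proof -
  let ?m = "moment a b c t" and ?g = "genfun a b c t z"
  note g = genfun_sums[OF K z b0 c0]
  have z0: "z \<noteq> 0" using z Jnorm_nonneg[OF K] by auto
  have m01: "?m 0 $ j = mat 1 $ 1 $ j" "?m (Suc 0) $ j = mat 1 $ 2 $ j" for j
    using exhaust_2[of j] by (auto simp: moment_def mat_def)
  have shift: "(\<lambda>n. f (Suc n) / z ^ (n + 1)) sums (z * s - f 0)"
    if "(\<lambda>n. f n / z ^ (n + 1)) sums s" for f :: "nat \<Rightarrow> complex" and s
  proof -
    have "(\<lambda>n. f (Suc n) / z ^ (Suc n + 1)) sums (s - f 0 / z)"
      using that by (subst sums_Suc_iff) simp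
    from sums_mult[OF this, of z] show ?thesis using z0 by (simp add: algebra_simps)
  qed
  have rhs: "rhs $ i $ j = (z * ?g $ i $ j - mat 1 $ i $ j)
      - (?g $ i $ 1 * ?m 1 $ j + ?g $ i $ 2 * ?m 2 $ j)" for i j
    using exhaust_2[of j]
    by (auto simp: rhs_def matrix_matrix_mult_def sum_2 mat_def algebra_simps)
  show "(\<lambda>n. moment_velocity a b c t n $ j / z ^ (n + 1)) sums rhs $ 1 $ j"
    using sums_diff[OF shift[OF g(1)[of j]]
        sums_add[OF sums_mult2[OF g(1)[of 1], of "?m 1 $ j"] sums_mult2[OF g(1)[of 2], of "?m 2 $ j"]]]
    unfolding rhs m01 moment_velocity_def vec_lambda_beta
    by (simp add: diff_divide_distrib add_divide_distrib)
  show "(\<lambda>n. moment_velocity a b c t (Suc n) $ j / z ^ (n + 1)) sums rhs $ 2 $ j"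
    using sums_diff[OF shift[OF g(2)[of j]]
        sums_add[OF sums_mult2[OF g(2)[of 1], of "?m 1 $ j"] sums_mult2[OF g(2)[of 2], of "?m 2 $ j"]]]
    unfolding rhs m01 moment_velocity_def vec_lambda_beta
    by (simp add: diff_divide_distrib add_divide_distrib)
qed

section \<open>The differential equation of the generating function\<close>

definition genfun_flow :: "coeffs \<Rightarrow> coeffs \<Rightarrow> coeffs \<Rightarrow> bool" where
  "genfun_flow a b c \<longleftrightarrow> (\<forall>t z. Jnorm a b c t < cmod z \<longrightarrow>
      ((\<lambda>s. genfun a b c s z) has_vector_derivative
         genfun a b c t z ** (mat z - vector [moment a b c t 1, moment a b c t 2]) - mat 1) (at t))"

lemma has_vector_derivative_imp_Lipschitz:
  fixes f :: "real \<Rightarrow> 'a::real_normed_vector"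
  assumes "\<And>t. (f has_vector_derivative f' t) (at t)" and "\<And>t. norm (f' t) \<le> L"
  shows "norm (f s - f t) \<le> L * \<bar>s - t\<bar>"
proof -
  have "norm (f s - f t) \<le> L * norm (s - t)"
  proof (rule differentiable_bound[of UNIV f "\<lambda>t h. h *\<^sub>R f' t"])
    show "onorm (\<lambda>h. h *\<^sub>R f' t) \<le> L" for t
      using assms(2)[of t] by (intro onorm_bound) (auto simp: mult.commute[of L] intro: mult_left_mono order_trans[OF norm_ge_zero])
  qed (use assms(1) in \<open>auto simp: has_vector_derivative_def\<close>)
  then show ?thesis by simp
qed

text \<open>The system bounds the velocities of \<open>a\<close>, \<open>b\<close>, \<open>c\<close>
  by \<open>2 K\<close>, \<open>2 K^2 + 2 K\<close> and \<open>2 K^2\<close>. One Lipschitz constant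
  therefore serves all diagonals, uniformly in the index.\<close>

lemma toda_system_Jnorm_Lipschitz:
  assumes E: "toda_system a b c" and K: "\<And>t. coeff_bound a b c K t"
    and b0: "\<And>t. b 0 t = 0" and c0: "\<And>t. c 0 t = 0"
  shows "Jnorm a b c s \<le> Jnorm a b c t + 3 * ((2 * K + 2 * K * K) * \<bar>s - t\<bar>)"
proof (rule Jnorm_Lipschitz[OF K K])
  note K' = K[unfolded coeff_bound_def]
  have K0: "0 \<le> K" using K' by blast
  show "0 \<le> (2 * K + 2 * K * K) * \<bar>s - t\<bar>" using K0 by simp
  fix n :: nat
  assume n: "n \<ge> 1"
  have a: "cmod (a m t) \<le> K" if "m \<ge> 1" for m t using K' that by blast
  have b: "cmod (b m t) \<le> K" for m t using K' K0 b0 by (cases m) auto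
  have c: "cmod (c m t) \<le> K" for m t using K' K0 c0 by (cases m) auto
  have aa: "cmod (a m t - a n t) \<le> 2 * K" if "m \<ge> 1" for m t
    using norm_triangle_ineq4[of "a m t" "a n t"] a[OF that, of t] a[OF n, of t] by linarith
  have prod: "cmod (x * (a m t - a n t)) \<le> K * (2 * K)" if "cmod x \<le> K" "m \<ge> 1" for x m t
    unfolding norm_mult using that K0 aa by (intro mult_mono) auto
  have "0 \<le> K * K" using K0 by simp
  note E' = E[unfolded toda_system_def, rule_format, OF n]
  have "cmod (a n s - a n t) \<le> (2 * K + 2 * K * K) * \<bar>s - t\<bar>"
  proof (rule has_vector_derivative_imp_Lipschitz)
    show "(a n has_vector_derivative b n t - b (n - 1) t) (at t)" for t using E' by blast
    show "cmod (b n t - b (n - 1) t) \<le> 2 * K + 2 * K * K" for t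
      using norm_triangle_ineq4[of "b n t" "b (n - 1) t"] b[of n t] b[of "n - 1" t] \<open>0 \<le> K * K\<close> by linarith
  qed
  moreover have "cmod (b n s - b n t) \<le> (2 * K + 2 * K * K) * \<bar>s - t\<bar>"
  proof (rule has_vector_derivative_imp_Lipschitz)
    show "(b n has_vector_derivative b n t * (a (n + 1) t - a n t) + c n t - c (n - 1) t) (at t)" for t
      using E' by blast
    show "cmod (b n t * (a (n + 1) t - a n t) + c n t - c (n - 1) t) \<le> 2 * K + 2 * K * K" for t
      using norm_triangle_ineq4[of "b n t * (a (n + 1) t - a n t) + c n t" "c (n - 1) t"]
        norm_triangle_ineq[of "b n t * (a (n + 1) t - a n t)" "c n t"]
        prod[of "b n t" "n + 1" t] b[of n t] c[of n t] c[of "n - 1" t] by simp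
  qed
  moreover have "cmod (c n s - c n t) \<le> (2 * K + 2 * K * K) * \<bar>s - t\<bar>"
  proof (rule has_vector_derivative_imp_Lipschitz)
    show "(c n has_vector_derivative c n t * (a (n + 2) t - a n t)) (at t)" for t using E' by blast
    show "cmod (c n t * (a (n + 2) t - a n t)) \<le> 2 * K + 2 * K * K" for t
      using prod[of "c n t" "n + 2" t] c[of n t] K0 by simp
  qed
  ultimately show "cmod (a n s - a n t) \<le> (2 * K + 2 * K * K) * \<bar>s - t\<bar> \<and>
    cmod (b n s - b n t) \<le> (2 * K + 2 * K * K) * \<bar>s - t\<bar> \<and>
    cmod (c n s - c n t) \<le> (2 * K + 2 * K * K) * \<bar>s - t\<bar>" by blast
qed

text \<open>Differentiability at \<open>t\<close> for all \<open>\<bar>z\<bar> > \<parallel>J(t)\<parallel>\<close> needs the Neumann series near \<open>t\<close>, hence the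
  Lipschitz bound for the operator norm.\<close>

lemma toda_system_imp_genfun_flow:
  assumes E: "toda_system a b c" and flow: "moment_flow a b c" and K: "\<And>t. coeff_bound a b c K t"
    and b0: "\<And>t. b 0 t = 0" and c0: "\<And>t. c 0 t = 0"
  shows "genfun_flow a b c"
  unfolding genfun_flow_def
proof (intro allI impI)
  fix t z
  assume z: "Jnorm a b c t < cmod z"
  define rhs where "rhs = genfun a b c t z ** (mat z - vector [moment a b c t 1, moment a b c t 2]) - mat 1"
  \<comment> \<open>The midpoint \<open>\<rho>\<close> leaves room on both sides: the radius
    \<open>\<delta>\<close> below keeps the operator norm at most \<open>\<rho>\<close> on
    \<open>S\<close>, and \<open>\<rho> < cmod z\<close> gives the geometric majorant. The 1 added
    in \<open>L\<close> makes it positive.\<close>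
  define \<rho> where "\<rho> = (Jnorm a b c t + cmod z) / 2"
  have \<rho>: "Jnorm a b c t < \<rho>" "\<rho> < cmod z" "0 \<le> \<rho>"
    using z Jnorm_nonneg[OF K, of t] by (auto simp: \<rho>_def)
  have K0: "0 \<le> K" using K by (auto simp: coeff_bound_def)
  define L where "L = 3 * (2 * K + 2 * K * K) + 1"
  have L: "L > 0" using K0 by (auto simp: L_def intro: add_nonneg_pos)
  define \<delta> where "\<delta> = (\<rho> - Jnorm a b c t) / L"
  have \<delta>: "\<delta> > 0" using \<rho> L by (simp add: \<delta>_def)
  define S where "S = ball t \<delta>"
  have S: "convex S" "t \<in> S" "open S" using \<delta> by (auto simp: S_def)
  have J: "Jnorm a b c s \<le> \<rho>" if "s \<in> S" for s
  proof -
    have "3 * ((2 * K + 2 * K * K) * \<bar>s - t\<bar>) \<le> L * \<bar>s - t\<bar>"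
      by (simp add: L_def algebra_simps)
    also have "\<dots> \<le> L * \<delta>"
      using that L by (intro mult_left_mono) (auto simp: S_def dist_real_def)
    also have "\<dots> = \<rho> - Jnorm a b c t" using L by (simp add: \<delta>_def)
    finally show ?thesis
      using toda_system_Jnorm_Lipschitz[OF E K b0 c0, of s t] by simp
  qed
  have Jz: "Jnorm a b c s < cmod z" if "s \<in> S" for s using J[OF that] \<rho> by simp
  define C where "C = (1 + K) * \<rho> + 2 * (1 + K)\<^sup>2 * (\<rho> + \<rho>\<^sup>2)"
  have C: "0 \<le> C" using K0 \<rho> by (simp add: C_def)
  have vel: "cmod (moment_velocity a b c s n $ j) \<le> C * \<rho> ^ n" if "s \<in> S" for s n j
    unfolding C_def by (rule moment_velocity_bound[OF K b0 c0 J[OF that]])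
  have deriv: "((\<lambda>s. moment a b c s n $ j) has_vector_derivative moment_velocity a b c s n $ j) (at s within S)"
    for n s j
    using flow by (simp add: moment_flow_velocity has_vector_derivative_at_within)
  have "((\<lambda>s. genfun a b c s z $ 1 $ j) has_vector_derivative rhs $ 1 $ j) (at t)" for j
  proof -
    have "\<exists>P. (\<forall>s\<in>S. (\<lambda>n. moment a b c s n $ j / z ^ (n + 1)) sums P s) \<and>
      (\<forall>s\<in>S. (P has_vector_derivative (\<Sum>n. moment_velocity a b c s n $ j / z ^ (n + 1))) (at s within S))"
      by (rule inverse_power_series_has_vector_derivative[OF S(1,2) deriv vel \<rho>(3,2)
            genfun_sums(1)[OF K z b0 c0]])
    then obtain P where P: "\<forall>s\<in>S. (\<lambda>n. moment a b c s n $ j / z ^ (n + 1)) sums P s"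
      "\<forall>s\<in>S. (P has_vector_derivative (\<Sum>n. moment_velocity a b c s n $ j / z ^ (n + 1))) (at s within S)"
      by (elim exE conjE) (rule that)
    note P = P[rule_format]
    have "(P has_vector_derivative rhs $ 1 $ j) (at t)"
      using P(2)[OF S(2)]
      unfolding at_within_open[OF S(2,3)] sums_unique[OF genfun_rhs_sums(1)[OF K z b0 c0], symmetric]
        rhs_def .
    then show ?thesis
      by (rule has_vector_derivative_transform_within_open[OF _ S(3,2)])
        (rule sums_unique2[OF P(1) genfun_sums(1)[OF K Jz b0 c0]])
  qed
  moreover have "((\<lambda>s. genfun a b c s z $ 2 $ j) has_vector_derivative rhs $ 2 $ j) (at t)" for j
  proof -
    \<comment> \<open>The second row uses moments shifted by one, which costs one factor
      \<open>\<rho>\<close> in the constant.\<close>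
    have vel': "cmod (moment_velocity a b c s (Suc n) $ j) \<le> (C * \<rho>) * \<rho> ^ n" if "s \<in> S" for s n
      using vel[OF that, of "Suc n" j] by (simp add: mult.assoc)
    have "\<exists>P. (\<forall>s\<in>S. (\<lambda>n. moment a b c s (Suc n) $ j / z ^ (n + 1)) sums P s) \<and>
      (\<forall>s\<in>S. (P has_vector_derivative (\<Sum>n. moment_velocity a b c s (Suc n) $ j / z ^ (n + 1))) (at s within S))"
      by (rule inverse_power_series_has_vector_derivative[OF S(1,2) deriv vel' \<rho>(3,2)
            genfun_sums(2)[OF K z b0 c0]])
    then obtain P where P: "\<forall>s\<in>S. (\<lambda>n. moment a b c s (Suc n) $ j / z ^ (n + 1)) sums P s"
      "\<forall>s\<in>S. (P has_vector_derivative (\<Sum>n. moment_velocity a b c s (Suc n) $ j / z ^ (n + 1))) (at s within S)"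
      by (elim exE conjE) (rule that)
    note P = P[rule_format]
    have "(P has_vector_derivative rhs $ 2 $ j) (at t)"
      using P(2)[OF S(2)]
      unfolding at_within_open[OF S(2,3)] sums_unique[OF genfun_rhs_sums(2)[OF K z b0 c0], symmetric]
        rhs_def .
    then show ?thesis
      by (rule has_vector_derivative_transform_within_open[OF _ S(3,2)])
        (rule sums_unique2[OF P(1) genfun_sums(2)[OF K Jz b0 c0]])
  qed
  ultimately show "((\<lambda>s. genfun a b c s z) has_vector_derivative
         genfun a b c t z ** (mat z - vector [moment a b c t 1, moment a b c t 2]) - mat 1) (at t)"
    unfolding has_vector_derivative_matrix2_iff rhs_def[symmetric] by (simp add: forall_2)
qed

text \<open>Only large \<open>z\<close> are needed for the converse. With \<open>p\<^sub>n\<close> the antiderivatives of the right-hand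
  sides of the moment equations, the series of the \<open>p\<^sub>n\<close> and the generating function have the same
  derivative, so that \<open>p\<^sub>n\<close> is the \<open>n\<close>-th moment.\<close>

lemma genfun_flow_imp_moment_flow:
  assumes diff: "\<forall>n\<ge>1. \<forall>t. a n differentiable (at t) \<and> b n differentiable (at t) \<and> c n differentiable (at t)"
    and flow: "genfun_flow a b c" and K: "\<And>t. coeff_bound a b c K t"
    and b0: "\<And>t. b 0 t = 0" and c0: "\<And>t. c 0 t = 0"
  shows "moment_flow a b c"
  unfolding moment_flow_velocity
proof (intro allI)
  fix N t and j :: 2
  define S where "S = {t - 1..t + (1::real)}"
  have S: "convex S" "t \<in> S" by (auto simp: S_def)
  \<comment> \<open>This bounds the operator norm at every time, so a single region of large z works
    on the whole interval.\<close>
  define \<rho> where "\<rho> = 3 * K + 1"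
  have K0: "0 \<le> K" using K by (auto simp: coeff_bound_def)
  have \<rho>: "0 < \<rho>" using K0 by (simp add: \<rho>_def)
  have J: "Jnorm a b c s \<le> \<rho>" for s unfolding \<rho>_def by (rule Jnorm_le[OF K])
  let ?m = "\<lambda>n s. moment a b c s n $ j" and ?v = "\<lambda>n s. moment_velocity a b c s n $ j"
  have "continuous_on S (\<lambda>s. moment a b c s n $ i)" for n i
  proof -
    have a: "continuous_on S (a 1)"
      using diff by (intro differentiable_imp_continuous_on) (auto simp: differentiable_on_def intro: differentiable_at_withinI)
    have x: "continuous_on S (\<lambda>s. jrow a b c s n k)" for k
      using jrow_differentiable[OF diff]
      by (intro differentiable_imp_continuous_on) (auto simp: differentiable_on_def intro: differentiable_at_withinI)
    show ?thesis
      using exhaust_2[of i] by (rule disjE) (simp_all only: moment_def vector_2, (intro continuous_intros a x)+)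
  qed
  note moment_cont = this
  have cont: "continuous_on {t - 1..t + 1} (?v n)" for n
    unfolding moment_velocity_def vec_lambda_beta S_def[symmetric]
    by (intro continuous_on_diff continuous_on_add continuous_on_mult moment_cont)
  have "\<exists>p. (\<forall>s\<in>S. (p has_vector_derivative ?v n s) (at s within S)) \<and> p t = ?m n t" for n
  proof -
    obtain g where g: "\<And>s. s \<in> S \<Longrightarrow> (g has_vector_derivative ?v n s) (at s within S)"
      using antiderivative_continuous[OF cont[of n]] unfolding S_def by blast
    show ?thesis
      by (rule exI[of _ "\<lambda>s. g s + (?m n t - g t)"]) (auto intro!: derivative_eq_intros g)
  qed
  then obtain p where p: "\<And>n s. s \<in> S \<Longrightarrow> (p n has_vector_derivative ?v n s) (at s within S)"
    and p_t: "\<And>n. p n t = ?m n t" by metis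
  \<comment> \<open>The first-row entry and the series of the \<open>p n\<close> have equal
    derivatives on \<open>S\<close> and equal values at \<open>t\<close>, hence coincide
    there.\<close>
  have sums0: "(\<lambda>n. (p n s - ?m n s) / z ^ (n + 1)) sums 0" if s: "s \<in> S" and z: "\<rho> < cmod z" for s z
  proof -
    have Jz: "Jnorm a b c s < cmod z" for s using J[of s] z by simp
    have at_t: "(\<lambda>n. p n t / z ^ (n + 1)) sums genfun a b c t z $ 1 $ j"
      using genfun_sums(1)[OF K Jz b0 c0] p_t by simp
    have "\<exists>P. (\<forall>s\<in>S. (\<lambda>n. p n s / z ^ (n + 1)) sums P s) \<and>
      (\<forall>s\<in>S. (P has_vector_derivative (\<Sum>n. ?v n s / z ^ (n + 1))) (at s within S))"
      by (rule inverse_power_series_has_vector_derivative[OF S p moment_velocity_bound[OF K b0 c0 J]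
          less_imp_le[OF \<rho>] z at_t])
    then obtain P where P: "\<forall>s\<in>S. (\<lambda>n. p n s / z ^ (n + 1)) sums P s"
      "\<forall>s\<in>S. (P has_vector_derivative (\<Sum>n. ?v n s / z ^ (n + 1))) (at s within S)"
      by (elim exE conjE) (rule that)
    note P = P[rule_format]
    have const: "((\<lambda>s. P s - genfun a b c s z $ 1 $ j) has_vector_derivative 0) (at s within S)" if "s \<in> S" for s
    proof -
      have "((\<lambda>s. genfun a b c s z $ 1 $ j) has_vector_derivative (\<Sum>n. ?v n s / z ^ (n + 1))) (at s within S)"
        using flow[unfolded genfun_flow_def has_vector_derivative_matrix2_iff, rule_format, OF Jz[of s], of 1 j]
        unfolding sums_unique[OF genfun_rhs_sums(1)[OF K Jz b0 c0]]
        by (rule has_vector_derivative_at_within)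
      from has_vector_derivative_diff[OF P(2)[OF that] this] show ?thesis by simp
    qed
    obtain C where C: "\<And>s. s \<in> S \<Longrightarrow> P s - genfun a b c s z $ 1 $ j = C"
      by (rule has_vector_derivative_zero_constant[OF S(1) const]) (assumption, rule that, blast)
    have "P t = genfun a b c t z $ 1 $ j"
      by (rule sums_unique2[OF P(1)[OF S(2)] at_t])
    then have "P s = genfun a b c s z $ 1 $ j" using C[OF s] C[OF S(2)] by simp
    then show ?thesis
      using sums_diff[OF P(1)[OF s] genfun_sums(1)[where t = s and j = j, OF K Jz b0 c0]]
      by (simp add: diff_divide_distrib)
  qed
  have p_eq: "p n s = ?m n s" if s: "s \<in> S" for n s
  proof -
    have "p n s - ?m n s = 0"
    proof (rule powser_sums_zero_imp_coeff_zero[of "1 / \<rho>"])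
      fix w :: complex
      assume w: "w \<noteq> 0" "cmod w < 1 / \<rho>"
      \<comment> \<open>With \<open>z = 1 / w\<close> the inverse power series becomes a power
        series carrying one surplus factor \<open>w\<close>, removed in the next line.\<close>
      then have "\<rho> < cmod (1 / w)" using \<rho> by (simp add: norm_divide field_simps)
      from sums_mult[OF sums0[OF s this], of "1 / w"] show "(\<lambda>n. (p n s - ?m n s) * w ^ n) sums 0"
        using w by (simp add: power_divide)
    qed (use \<rho> in simp)
    then show ?thesis by simp
  qed
  have "(?m N has_vector_derivative ?v N t) (at t within S)"
    by (rule has_vector_derivative_transform[OF S(2) _ p[OF S(2)]]) (simp add: p_eq)
  moreover have "at t within S = at t"
    unfolding S_def by (rule at_within_Icc_at) auto
  ultimately show "(?m N has_vector_derivative ?v N t) (at t)" by simp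
qed

section \<open>The block recurrence\<close>

text \<open>The two components of the block equation are the scalar equations at
  \<open>2 * n\<close> and \<open>2 * n + 1\<close>. For \<open>n = 0\<close> the exceptional
  \<open>C_0\<close> multiplies the zero vector, in agreement with
  \<open>b 0 = c 0 = 0\<close>.\<close>

lemma Bvec_flow_iff:
  assumes b0: "\<And>t. b 0 t = 0" and c0: "\<And>t. c 0 t = 0"
  shows "(\<forall>n t z. ((\<lambda>s. poly_vec (Bvec a b c s (int n)) z) has_vector_derivative
         - (Cmat a b c n t *v poly_vec (Bvec a b c t (int n - 1)) z)
         - Dmat b n t *v poly_vec (Bvec a b c t (int n)) z) (at t)) \<longleftrightarrow>
    (\<forall>k z t. ((\<lambda>s. poly (recP a b c s k) z) has_vector_derivative
     - (b k t * poly (recP a b c t (k - 1)) z + c (k - 1) t * poly (recP a b c t (k - 2)) z)) (at t))"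
    (is "(\<forall>n t z. ?B n t z) \<longleftrightarrow> (\<forall>k z t. ?P k z t)")
proof -
  have B: "?B n t z \<longleftrightarrow> ?P (2 * n) z t \<and> ?P (2 * n + 1) z t" for n t z
  proof -
    define r where "r = - (Cmat a b c n t *v poly_vec (Bvec a b c t (int n - 1)) z)
         - Dmat b n t *v poly_vec (Bvec a b c t (int n)) z"
    have "r $ 1 = - (b (2 * n) t * poly (recP a b c t (2 * n - 1)) z + c (2 * n - 1) t * poly (recP a b c t (2 * n - 2)) z) \<and>
      r $ 2 = - (b (2 * n + 1) t * poly (recP a b c t (2 * n)) z + c (2 * n) t * poly (recP a b c t (2 * n - 1)) z)"
    proof (cases n)
      case 0
      then show ?thesis
        by (simp add: r_def poly_vec_def Bvec_def Dmat_def matrix_vector_mult_def sum_2 b0 c0)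
    next
      case (Suc m)
      moreover have "nat (1 + int m) = Suc m" by simp
      ultimately show ?thesis
        by (simp add: r_def poly_vec_def Bvec_def Cmat_def Dmat_def matrix_vector_mult_def sum_2 algebra_simps
            del: recP.simps)
    qed
    then show ?thesis
      unfolding r_def[symmetric] has_vector_derivative_vec_iff forall_2
      by (simp add: poly_vec_def Bvec_def nat_mult_distrib del: recP.simps)
  qed
  show ?thesis
    unfolding B
  proof (intro iffI allI conjI)
    fix k :: nat and z t
    assume H: "\<forall>n t z. ?P (2 * n) z t \<and> ?P (2 * n + 1) z t"
    obtain n where "k = 2 * n \<or> k = 2 * n + 1" by (metis evenE oddE)
    then show "?P k z t"
      using H[rule_format, where n = n and t = t and z = z] by (elim disjE) (simp_all only: simp_thms)
  next
    fix n t z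
    assume H: "\<forall>k z t. ?P k z t"
    show "?P (2 * n) z t" "?P (2 * n + 1) z t" by (rule H[rule_format])+
  qed
qed

section \<open>The Lax equation\<close>

text \<open>The product is an infinite series by definition; a banded row of the left factor leaves
  at most four terms, whatever the right factor.\<close>

lemma imat_mult_banded_row:
  assumes "\<And>l. l + 2 < m \<or> m + 1 < l \<Longrightarrow> M (Suc m) (Suc l) = 0"
  shows "imat_mult M N (Suc m) j = M (Suc m) (Suc m) * N (Suc m) j + M (Suc m) (Suc (Suc m)) * N (Suc (Suc m)) j
    + (if m \<ge> 1 then M (Suc m) m * N m j else 0) + (if m \<ge> 2 then M (Suc m) (m - 1) * N (m - 1) j else 0)"
proof -
  have "imat_mult M N (Suc m) j = (\<Sum>l\<in>{m - 2..m + 1}. M (Suc m) (Suc l) * N (Suc l) j)"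
    unfolding imat_mult_def by (rule suminf_finite) (use assms in \<open>auto simp: not_le less_diff_conv\<close>)
  moreover consider "m = 0" | "m = 1" | k where "m = k + 2"
    by (metis One_nat_def Suc_eq_plus1 add_2_eq_Suc' not0_implies_Suc)
  then have "(\<Sum>l\<in>{m - 2..m + 1}. M (Suc m) (Suc l) * N (Suc l) j)
    = M (Suc m) (Suc m) * N (Suc m) j + M (Suc m) (Suc (Suc m)) * N (Suc (Suc m)) j
    + (if m \<ge> 1 then M (Suc m) m * N m j else 0) + (if m \<ge> 2 then M (Suc m) (m - 1) * N (m - 1) j else 0)"
  proof cases
    case 2
    then have "{m - 2..m + 1} = {0, 1, 2}" by auto
    with 2 show ?thesis by (simp add: numeral_2_eq_2)
  next
    case (3 k)
    then have "{m - 2..m + 1} = {k, k + 1, k + 2, k + 3}" by auto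
    with 3 show ?thesis by (simp add: numeral_2_eq_2 numeral_3_eq_3)
  qed simp
  ultimately show ?thesis by simp
qed

text \<open>[J, J_-] equals the commutator of the upper part of J with J_-. The upper part reaches
  at most one diagonal upwards and J_- one or two downwards, so only three diagonals can be
  nonzero.\<close>

lemma imat_commutator_Jmat:
  assumes b0: "b 0 t = 0" and c0: "c 0 t = 0" and "i \<ge> 1" "j \<ge> 1"
  shows "imat_commutator (Jmat a b c t) (strictly_lower (Jmat a b c t)) i j =
    (if i = j then b j t - b (j - 1) t
     else if i = j + 1 then b j t * (a (j + 1) t - a j t) + c j t - c (j - 1) t
     else if i = j + 2 then c j t * (a (j + 2) t - a j t)
     else 0)"
proof -
  let ?J = "Jmat a b c t" and ?L = "strictly_lower (Jmat a b c t)"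
  obtain m where i: "i = Suc m" using \<open>i \<ge> 1\<close> by (cases i) auto
  have J: "imat_mult ?J N (Suc m) j = a (Suc m) t * N (Suc m) j + N (Suc (Suc m)) j
      + b m t * N m j + c (m - 1) t * N (m - 1) j" for N
    by (subst imat_mult_banded_row) (auto simp: Jmat_def b0 c0 not_le less_Suc_eq numeral_2_eq_2)
  have L: "imat_mult ?L N (Suc m) j = b m t * N m j + c (m - 1) t * N (m - 1) j" for N
    by (subst imat_mult_banded_row)
      (auto simp: strictly_lower_def Jmat_def b0 c0 not_le less_Suc_eq numeral_2_eq_2)
  \<comment> \<open>The \<open>b\<close> and \<open>c\<close> terms of the two products combine:
    subtracting J from its strictly lower part leaves minus the upper part.\<close>
  have eq: "imat_commutator ?J ?L i j = a (Suc m) t * ?L (Suc m) j + ?L (Suc (Suc m)) j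
      - b m t * (if j < m then 0 else ?J m j) - c (m - 1) t * (if j < m - 1 then 0 else ?J (m - 1) j)"
    unfolding imat_commutator_def i J L by (simp add: strictly_lower_def)
  consider "j > i" | "i = j" | "i = j + 1" | "i = j + 2" | "i > j + 2" by linarith
  then show ?thesis
  proof cases
    case 1
    then show ?thesis unfolding eq using i by (auto simp: strictly_lower_def Jmat_def)
  next
    case 2
    then show ?thesis unfolding eq using i by (cases m) (auto simp: strictly_lower_def Jmat_def b0 c0)
  next
    case 3
    then have "m = j" using i by simp
    obtain k where "j = Suc k" using \<open>j \<ge> 1\<close> by (cases j) auto
    then show ?thesis unfolding eq using \<open>m = j\<close> 3
      by (simp add: strictly_lower_def Jmat_def algebra_simps)
  next
    case 4
    then have "m = Suc j" using i by simp
    then show ?thesis unfolding eq using 4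
      by (simp add: strictly_lower_def Jmat_def algebra_simps)
  next
    case 5
    then show ?thesis unfolding eq using i by (auto simp: strictly_lower_def Jmat_def)
  qed
qed

text \<open>The diagonal and the two subdiagonals carry the three equations; all remaining entries
  of J are constant in time and the commutator vanishes there.\<close>

lemma toda_system_iff_Lax:
  assumes b0: "\<And>t. b 0 t = 0" and c0: "\<And>t. c 0 t = 0"
  shows "toda_system a b c \<longleftrightarrow> (\<forall>i\<ge>1. \<forall>j\<ge>1. \<forall>t.
      ((\<lambda>s. Jmat a b c s i j) has_vector_derivative
         imat_commutator (Jmat a b c t) (strictly_lower (Jmat a b c t)) i j) (at t))"
    (is "_ \<longleftrightarrow> ?Lax")
proof
  assume E: "toda_system a b c"
  show ?Lax
  proof (intro allI impI)
    fix i j :: nat and t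
    assume ij: "i \<ge> 1" "j \<ge> 1"
    note E' = E[unfolded toda_system_def, rule_format, OF ij(2), of t]
    consider "i = j" | "i = j + 1" | "i = j + 2" | "i \<noteq> j" "i \<noteq> j + 1" "i \<noteq> j + 2" by blast
    then show "((\<lambda>s. Jmat a b c s i j) has_vector_derivative
         imat_commutator (Jmat a b c t) (strictly_lower (Jmat a b c t)) i j) (at t)"
      unfolding imat_commutator_Jmat[of b t c i j a, OF b0 c0 ij]
      by cases (use E' in \<open>auto simp: Jmat_def cong: if_cong\<close>)
  qed
next
  assume Lax: ?Lax
  show "toda_system a b c"
    unfolding toda_system_def
  proof (intro allI impI)
    fix n :: nat and t
    assume n: "n \<ge> 1"
    have "((\<lambda>s. Jmat a b c s (n + k) n) has_vector_derivative
         imat_commutator (Jmat a b c t) (strictly_lower (Jmat a b c t)) (n + k) n) (at t)" for k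
      using Lax n by simp
    from this[of 0] this[of 1] this[of 2]
    show "(a n has_vector_derivative b n t - b (n - 1) t) (at t) \<and>
      (b n has_vector_derivative b n t * (a (n + 1) t - a n t) + c n t - c (n - 1) t) (at t) \<and>
      (c n has_vector_derivative c n t * (a (n + 2) t - a n t)) (at t)"
      using n by (simp add: imat_commutator_Jmat[where a = a and b = b and c = c, OF b0 c0] Jmat_def)
  qed
qed

section \<open>Assembly of the equivalences\<close>

theorem theorem2:
  fixes a b c :: "nat \<Rightarrow> real \<Rightarrow> complex"
    and W U :: "real \<Rightarrow> complex poly^2 \<Rightarrow> complex^2^2"
  assumes diff: "\<forall>n\<ge>1. \<forall>t. a n differentiable (at t) \<and> b n differentiable (at t) \<and> c n differentiable (at t)"
    and bounded: "\<exists>K>0. \<forall>n\<ge>1. \<forall>t. max (cmod (a n t)) (max (cmod (b n t)) (cmod (c n t))) \<le> K"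
    and nonzero: "\<forall>n\<ge>1. \<forall>t. c n t \<noteq> 0"
    and a1: "\<forall>t. (a 1 has_vector_derivative b 1 t) (at t)"
    and index0: "\<forall>t. b 0 t = 0" "\<forall>t. c 0 t = 0"
    and W: "\<forall>t. vector_of_functionals a b c t (W t)"
    and W_inv: "\<forall>t. invertible (W t (Bvec a b c t 0))"
    and U: "\<forall>t. U t = right_mult_functional (W t) (matrix_inv (W t (Bvec a b c t 0)) ** Cmat a b c 0 t)"
  defines "E \<equiv> \<forall>n\<ge>1. \<forall>t.
      (a n has_vector_derivative b n t - b (n - 1) t) (at t) \<and>
      (b n has_vector_derivative b n t * (a (n + 1) t - a n t) + c n t - c (n - 1) t) (at t) \<and>
      (c n has_vector_derivative c n t * (a (n + 2) t - a n t)) (at t)"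
    and "Lax \<equiv> \<forall>i\<ge>1. \<forall>j\<ge>1. \<forall>t.
      ((\<lambda>s. Jmat a b c s i j) has_vector_derivative
         imat_commutator (Jmat a b c t) (strictly_lower (Jmat a b c t)) i j) (at t)"
    and "F \<equiv> \<forall>n t.
      ((\<lambda>s. U s (monom 1 n *s Pvec 0)) has_vector_derivative
         U t (monom 1 (n + 1) *s Pvec 0) - U t (monom 1 n *s Pvec 0) ** U t (monom 1 1 *s Pvec 0)) (at t)"
    and "G \<equiv> \<forall>t \<zeta>. Jnorm a b c t < cmod \<zeta> \<longrightarrow>
      ((\<lambda>s. genfun a b c s \<zeta>) has_vector_derivative
         genfun a b c t \<zeta> ** (mat \<zeta> - U t (monom 1 1 *s Pvec 0)) - mat 1) (at t)"
    and "H \<equiv> \<forall>Q t.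
      ((\<lambda>s. U s Q) has_vector_derivative
         U t (monom 1 1 *s Q) - U t Q ** U t (monom 1 1 *s Pvec 0)) (at t)"
    and "I \<equiv> \<forall>n t z.
      ((\<lambda>s. poly_vec (Bvec a b c s (int n)) z) has_vector_derivative
         - (Cmat a b c n t *v poly_vec (Bvec a b c t (int n - 1)) z)
         - Dmat b n t *v poly_vec (Bvec a b c t (int n)) z) (at t)"
  shows "(E \<longleftrightarrow> Lax) \<and> (E \<longleftrightarrow> F) \<and> (E \<longleftrightarrow> G) \<and> (E \<longleftrightarrow> H) \<and> (E \<longleftrightarrow> I)"
proof -
  note b0 = index0(1)[rule_format] and c0 = index0(2)[rule_format]
  obtain K where "K > 0"
    and "\<forall>n\<ge>1. \<forall>t. max (cmod (a n t)) (max (cmod (b n t)) (cmod (c n t))) \<le> K"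
    using bounded by blast
  then have K: "coeff_bound a b c K t" for t by (simp add: coeff_bound_def)
  have U_eq: "U t Q $ i $ j = (\<Sum>n\<le>degree (Q $ i). coeff (Q $ i) n * moment a b c t n $ j)" for t Q i j
    unfolding U[rule_format]
    by (rule functional_eq_moments[where a = a and b = b and c = c, OF b0 c0 W[rule_format] W_inv[rule_format]])
  have E: "E \<longleftrightarrow> toda_system a b c" by (simp add: E_def toda_system_def)
  \<comment> \<open>The moment equations are the common form to which (f), (g) and (h) are
    reduced.\<close>
  have flow: "toda_system a b c \<longleftrightarrow> moment_flow a b c"
    using toda_system_imp_row_flow[where a = a and b = b and c = c, OF _ b0 c0] row_flow_imp_toda_system[where a = a and b = b and c = c, OF diff nonzero b0 c0]
      moment_flow_iff_row_flow[where a = a and b = b and c = c, OF a1] by blast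
  have F: "F \<longleftrightarrow> moment_flow a b c" and H: "H \<longleftrightarrow> moment_flow a b c"
    unfolding F_def H_def by (rule functional_flow_iff[OF U_eq])+
  have "U t (monom 1 1 *s Pvec 0) = vector [moment a b c t 1, moment a b c t 2]" for t
    using functional_power_eq_moment[OF U_eq, of t 1] by (simp add: numeral_2_eq_2)
  then have "G \<longleftrightarrow> genfun_flow a b c" by (simp add: G_def genfun_flow_def)
  \<comment> \<open>The implication towards (g) uses the system as well as the moment equations,
    since the system controls the operator norm near each time; \<open>flow\<close> provides
    it.\<close>
  then have G: "G \<longleftrightarrow> moment_flow a b c"
    using toda_system_imp_genfun_flow[where a = a and b = b and c = c, OF _ _ K b0 c0] genfun_flow_imp_moment_flow[where a = a and b = b and c = c, OF diff _ K b0 c0] flow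
    by blast
  have I: "I \<longleftrightarrow> (\<forall>k z t. ((\<lambda>s. poly (recP a b c s k) z) has_vector_derivative
     - (b k t * poly (recP a b c t (k - 1)) z + c (k - 1) t * poly (recP a b c t (k - 2)) z)) (at t))"
    unfolding I_def by (rule Bvec_flow_iff[where a = a and b = b and c = c, OF b0 c0])
  show ?thesis
    using E Lax_def toda_system_iff_Lax[where a = a and b = b and c = c, OF b0 c0] flow F H G I
      toda_system_iff_recP_flow[where a = a and b = b and c = c, OF diff b0 c0] by blast
qed

end
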